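(* Let $p$ be an odd prime and let $G$ be a finite group satisfying the property $\mathcal{P}(2p;x,y)$ for some $x,y\in G$. Then $|G|\ge8p^2$.
   Context: For a finite group $G$ and $\ell\ge1$, $r_\ell(g)=\#\{h\in G:h^\ell=g\}$. For a positive squarefree integer $d$, a finite group $G$ satisfies the property $\mathcal{P}(d;x,y)$ if $x,y\in G$ are elements of the same order such that $r_\ell(x)=r_\ell(y)$ for all (positive) squarefree integers $\ell<d$, and $r_d(x)<r_d(y)$. *)

theory Defs
  imports "HOL-Algebra.Algebra" "HOL-Computational_Algebra.Computational_Algebra"
begin

definition num_roots :: "('a, 'b) monoid_scheme \<Rightarrow> nat \<Rightarrow> 'a \<Rightarrow> nat" where
  "num_roots G l g = card {h \<in> carrier G. h [^]\<^bsub>G\<^esub> l = g}"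

text \<open>No separate positivity condition on \<open>l\<close> is needed below: on \<^typ>\<open>nat\<close>, \<open>squarefree 0\<close> is false.\<close>

definition root_property :: "('a, 'b) monoid_scheme \<Rightarrow> nat \<Rightarrow> 'a \<Rightarrow> 'a \<Rightarrow> bool" where
  "root_property G d x y \<longleftrightarrow>
     squarefree d \<and> x \<in> carrier G \<and> y \<in> carrier G \<and> group.ord G x = group.ord G y \<and>
     (\<forall>l<d. squarefree l \<longrightarrow> num_roots G l x = num_roots G l y) \<and>
     num_roots G d x < num_roots G d y"

end

theory Submission
  imports Defs
begin

text \<open>
  Let \<open>n\<close> be the common order of \<open>x\<close> and \<open>y\<close>, and suppose that \<open>|G| < 8p\<^sup>2\<close>. For \<open>k\<close> prime to
  \<open>|G|\<close> the map \<open>h \<mapsto> h\<^sup>k\<close> permutes \<open>G\<close>, so elements of the same order in one cyclic subgroup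
  have equally many \<open>l\<close>-th roots (\<open>num_roots_le_in_cyc\<close>); so do conjugate elements. Hence no
  conjugate of \<open>x\<close> shares a cyclic subgroup with \<open>y\<close>. Every case below contradicts this, or the
  bound on \<open>|G|\<close>.

  If \<open>p\<close> divides \<open>n\<close>, then \<open>p\<close>-th roots \<open>a\<close> of \<open>x\<close> and \<open>g\<close> of \<open>y\<close> have order \<open>pn\<close>, which is so
  large that \<open>\<langle>g\<rangle>\<close> contains \<open>x\<close> or \<open>G\<close> is cyclic (\<open>num_roots_le_if_prime_dvd_ord\<close>).

  If \<open>p\<close> does not divide \<open>n\<close>, a \<open>2p\<close>-th root of \<open>y\<close> is a square root \<open>a\<close> of \<open>y\<close> together with a
  solution of \<open>z\<^sup>p = 1\<close> commuting with \<open>a\<close> (\<open>num_roots_mult_coprime\<close>). So the number of these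
  roots is \<open>\<Sum> f(a)\<close> over the square roots \<open>a\<close>, where the weight \<open>f(a)\<close> is the number of such \<open>z\<close>, while
  \<open>f(x) = f(y)\<close> because the \<open>p\<close>-th roots are equinumerous. Since the sum for \<open>y\<close> is the
  larger one, some square root \<open>b\<close> of \<open>y\<close> of order \<open>2n\<close> commutes with some \<open>z\<close> of order \<open>p\<close>.

  \<^item> If \<open>p\<^sup>2\<close> divides \<open>|G|\<close>, then \<open>|G| = 2np\<^sup>2\<close> with \<open>n\<close> prime, and counting modulo \<open>n\<close> gives \<open>x\<close>
    a fixed coset of \<open>\<langle>b\<rangle>\<close>, that is, a conjugate in \<open>\<langle>b\<rangle>\<close>.

  \<^item> Otherwise two commuting elements of order \<open>p\<close> generate the same subgroup, and a subgroup
    containing \<open>z\<close> in its centre has index at least \<open>p + 1\<close> in any subgroup that has another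
    subgroup of order \<open>p\<close>. This gives first that \<open>\<langle>z\<rangle>\<close> contains all \<open>p\<close>-torsion of \<open>C(y)\<close>.
    The two sums then only depend on how many square roots commute with the \<open>p\<close>-torsion, those
    that do not come in multiples of \<open>p\<close>, and it follows that at least \<open>p + 1\<close> (at least
    \<open>2p\<close> for even \<open>n\<close>) square roots of \<open>y\<close> commute with \<open>z\<close>. So \<open>C(y) \<inter> C(z)\<close> has at least
    \<open>np\<^sup>2\<close> elements. Now \<open>\<langle>z\<rangle>\<close> must be all the \<open>p\<close>-torsion of \<open>G\<close>, the proper subgroup
    \<open>C(z)\<close> contains \<open>x\<close>, and \<open>y\<close> is central in \<open>C(z)\<close>. This leaves odd \<open>n\<close> and \<open>n = 2\<close>.
    For odd \<open>n\<close> the square roots of \<open>y\<close> fill too much of \<open>C(z)\<close> modulo its central subgroup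
    \<open>\<langle>yz\<rangle>\<close>: a group with an element of order above \<open>2\<close> has at most three quarters of its
    elements squaring to \<open>1\<close> (\<open>card_squares_in_central_subgroup\<close>). For \<open>n = 2\<close> the numbers
    of square roots of \<open>x\<close> and of \<open>y\<close> in \<open>C(z)\<close> are both divisible by \<open>4\<close>
    (\<open>four_dvd_roots_of_central_involution\<close>), which doubles the lower bound \<open>2p\<close> to \<open>4p\<close>.
\<close>

section \<open>Arithmetic and counting\<close>

lemma nat_inverse_mod:
  fixes p m :: nat
  assumes "coprime p m" "p > 0"
  shows "\<exists>i j. p * i = m * j + 1"
  using bezout_nat[of p m] assms by auto

text \<open>
  A residue prime to \<open>n\<close> has a representative prime to \<open>N\<close>: add to \<open>k\<close> the multiple \<open>n t\<close>, where
  \<open>t\<close> is the product of the prime divisors of \<open>N\<close> that do not divide \<open>k\<close>.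
\<close>

lemma coprime_shift:
  fixes k n N :: nat
  assumes "coprime k n" "N > 0"
  shows "\<exists>t. coprime (k + n * t) N"
proof -
  define t where "t = \<Prod>{q \<in> prime_factors N. \<not> q dvd k}"
  have fin: "finite {q \<in> prime_factors N. \<not> q dvd k}" by simp
  have "coprime (k + n * t) N"
  proof (rule ccontr)
    assume "\<not> coprime (k + n * t) N"
    then obtain q where q: "Factorial_Ring.prime q" "q dvd k + n * t" "q dvd N"
      by (metis (no_types, lifting) coprime_iff_gcd_eq_1 gcd_greatest_iff prime_factor_nat)
    show False
    proof (cases "q dvd k")
      case True
      with q have "q dvd n * t" using dvd_add_right_iff by blast
      moreover have "\<not> q dvd n"
        using True assms(1) q(1) by (meson coprime_common_divisor not_prime_unit)
      ultimately have "q dvd t" using q(1) prime_dvd_mult_iff by blast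
      then obtain r where r: "r \<in> prime_factors N" "\<not> r dvd k" "q dvd r"
        unfolding t_def using prime_dvd_prod_iff[OF fin q(1), of "\<lambda>x. x"] by auto
      then have "q = r" using q(1) by (auto simp: in_prime_factors_iff primes_dvd_imp_eq)
      with r True show False by simp
    next
      case False
      have "q \<in> prime_factors N" using q assms(2) by (auto simp: in_prime_factors_iff)
      with False have "q dvd t" unfolding t_def using fin by (intro dvd_prodI) auto
      with q(2) False show False by (metis dvd_add_left_iff dvd_mult)
    qed
  qed
  then show ?thesis by blast
qed

text \<open>
  The sets \<open>blk a\<close> play the role of the orbits of a free action; this form avoids having to exhibit
  an acting group.
\<close>

lemma card_dvd_of_blocks:
  assumes "finite S"
    and "\<And>a. a \<in> S \<Longrightarrow> a \<in> blk a \<and> blk a \<subseteq> S \<and> card (blk a) = k"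
    and "\<And>a b. a \<in> S \<Longrightarrow> b \<in> blk a \<Longrightarrow> blk b = blk a"
  shows "k dvd card S"
proof -
  have U: "\<Union>(blk ` S) = S" using assms(2) by blast
  have "blk a \<inter> blk b = {}" if "a \<in> S" "b \<in> S" "blk a \<noteq> blk b" for a b
    using that assms(2,3) by (metis disjoint_iff)
  moreover have "\<forall>c\<in>blk ` S. k dvd card c"
    using assms(2) by fastforce
  ultimately have "k dvd card (\<Union>(blk ` S))"
    by (intro dvd_partition) (use U assms(1) in \<open>auto simp only: ball_simps\<close>)
  then show ?thesis by (simp add: U)
qed

section \<open>Subgroups, cyclic subgroups and numbers of roots\<close>

locale finite_group = group +
  assumes finite_carrier: "finite (carrier G)"
begin

definition centralizer :: "'a \<Rightarrow> 'a set" where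
  "centralizer g = {h \<in> carrier G. h \<otimes> g = g \<otimes> h}"

abbreviation cyc :: "'a \<Rightarrow> 'a set" where
  "cyc c \<equiv> generate G {c}"

lemma subgroup_cyc: "c \<in> carrier G \<Longrightarrow> subgroup (cyc c) G"
  by (simp add: generate_is_subgroup)

lemma mem_cyc_iff: "c \<in> carrier G \<Longrightarrow> h \<in> cyc c \<longleftrightarrow> (\<exists>k::nat. h = c [^] k)"
  using generate_pow_on_finite_carrier[OF finite_carrier] by blast

lemma card_cyc: "c \<in> carrier G \<Longrightarrow> card (cyc c) = ord c"
  using generate_pow_card by simp

lemma self_in_cyc: "c \<in> cyc c"
  by (simp add: generate.incl)

lemma cyc_subset: "c \<in> H \<Longrightarrow> subgroup H G \<Longrightarrow> cyc c \<subseteq> H"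
  by (simp add: generate_subgroup_incl)

lemma finite_subgroup: "subgroup H G \<Longrightarrow> finite H"
  using finite_carrier finite_subset subgroup.subset by blast

lemma subgroup_card_dvd:
  assumes "subgroup H G" "subgroup K G" "H \<subseteq> K"
  shows "card H dvd card K"
proof -
  interpret K: group "G\<lparr>carrier := K\<rparr>"
    using assms(2) by (rule subgroup_imp_group)
  have "subgroup H (G\<lparr>carrier := K\<rparr>)"
    using assms by (simp add: subgroup_incl)
  from K.lagrange[OF this] have "card (rcosets\<^bsub>G\<lparr>carrier := K\<rparr>\<^esub> H) * card H = card K"
    by (simp add: Coset.order_def)
  then show ?thesis by (metis dvd_triv_right)
qed

lemma subgroup_card_dvd_order:
  assumes "subgroup H G" shows "card H dvd card (carrier G)"
proof -
  have "card (rcosets H) * card H = card (carrier G)"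
    using lagrange[OF assms] by (simp add: Coset.order_def)
  then show ?thesis by (metis dvd_triv_right)
qed

lemma subgroup_card_pos: "subgroup H G \<Longrightarrow> card H > 0"
  by (auto simp: card_gt_0_iff finite_subgroup dest: subgroup.one_closed)

lemma ord_dvd_subgroup:
  assumes "subgroup H G" "c \<in> H" shows "ord c dvd card H"
  using subgroup_card_dvd[OF subgroup_cyc assms(1) cyc_subset] assms card_cyc
    subgroup.mem_carrier[OF assms] by simp

lemma ord_pos: "c \<in> carrier G \<Longrightarrow> ord c > 0"
  using ord_ge_1[OF finite_carrier] by fastforce

lemma subgroup_double:
  assumes "subgroup H G" "subgroup K G" "H \<subset> K"
  shows "2 * card H \<le> card K"
proof -
  from subgroup_card_dvd assms obtain k where k: "card K = card H * k" by (meson dvdE psubset_imp_subset)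
  have "card H < card K" using assms finite_subgroup psubset_card_mono by blast
  with k have "k \<noteq> 0 \<and> k \<noteq> 1" by auto
  then have "k \<ge> 2" by linarith
  with k show ?thesis by simp
qed

lemma subgroup_centralizer:
  assumes "g \<in> carrier G"
  shows "subgroup (centralizer g) G"
proof (rule subgroupI)
  show "centralizer g \<subseteq> carrier G" "centralizer g \<noteq> {}"
    using assms unfolding centralizer_def by auto
next
  fix a assume "a \<in> centralizer g"
  then have a: "a \<in> carrier G" "a \<otimes> g = g \<otimes> a" by (auto simp: centralizer_def)
  have "inv a \<otimes> g = inv a \<otimes> (g \<otimes> a) \<otimes> inv a" using a assms by (simp add: m_assoc)
  also have "\<dots> = g \<otimes> inv a" using a assms by (simp flip: a(2) add: m_assoc[symmetric])
  finally show "inv a \<in> centralizer g" using a by (simp add: centralizer_def)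
next
  fix a b assume "a \<in> centralizer g" "b \<in> centralizer g"
  then show "a \<otimes> b \<in> centralizer g" using assms unfolding centralizer_def
    by (auto simp: m_assoc) (metis m_assoc)
qed

lemma subgroup_pow_closed: "subgroup H G \<Longrightarrow> h \<in> H \<Longrightarrow> h [^] (k::nat) \<in> H"
  by (induction k) (auto simp: subgroup.one_closed subgroup.m_closed)

lemma centralizer_pow_subset:
  assumes "a \<in> carrier G"
  shows "centralizer a \<subseteq> centralizer (a [^] (k::nat))"
proof -
  have "a [^] k \<otimes> h = h \<otimes> a [^] k" if "h \<in> carrier G" "h \<otimes> a = a \<otimes> h" for h
    using group_commutes_pow[of a h k] that assms by simp
  then show ?thesis by (auto simp: centralizer_def)
qed

lemma centralizer_sym:
  "a \<in> carrier G \<Longrightarrow> b \<in> centralizer a \<Longrightarrow> a \<in> centralizer b"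
  by (auto simp: centralizer_def)

lemma pow_eq_mod:
  fixes i j :: nat
  assumes "c \<in> carrier G" "i mod ord c = j mod ord c"
  shows "c [^] i = c [^] j"
proof -
  have "c [^] i = c [^] (i mod ord c)" for i :: nat
  proof -
    have "c [^] i = c [^] (ord c * (i div ord c) + i mod ord c)" by simp
    also have "\<dots> = c [^] (i mod ord c)"
      unfolding nat_pow_mult[OF assms(1), symmetric]
      by (simp add: assms(1) nat_pow_pow[symmetric])
    finally show ?thesis .
  qed
  with assms(2) show ?thesis by metis
qed

lemma pow_inj_lt_ord:
  fixes i j :: nat
  assumes "c \<in> carrier G" "c [^] i = c [^] j" "i < ord c" "j < ord c"
  shows "i = j"
  using ord_inj[OF assms(1)] assms(2-) unfolding inj_on_def by fastforce

text \<open>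
  In \<open>\<langle>c\<rangle>\<close> both elements are powers of \<open>c\<^sup>d\<close> with \<open>d = ord c / ord y\<close>, and by Bezout \<open>c\<^sup>d\<close> is itself
  a power of \<open>y\<close>.
\<close>

lemma same_ord_in_cyc:
  assumes c: "c \<in> carrier G" and xy: "x \<in> cyc c" "y \<in> cyc c" and o: "ord x = ord y"
  shows "x \<in> cyc y"
proof -
  obtain i j :: nat where i: "x = c [^] i" and j: "y = c [^] j" using xy c by (auto simp: mem_cyc_iff)
  have y: "y \<in> carrier G" and x: "x \<in> carrier G" using c i j by auto
  define d where "d = gcd j (ord c)"
  have "d > 0" using ord_pos[OF c] by (simp add: d_def)
  have "c [^] (i * ord y) = \<one>" using pow_ord_eq_1[OF x] c unfolding o by (simp add: i nat_pow_pow)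
  then have "ord c dvd i * ord y" using c by (simp add: pow_eq_id)
  moreover have "ord c = d * ord y"
    using ord_pow_gen[OF c, of j] ord_pos[OF c] by (auto simp: j d_def gcd.commute)
  ultimately have "d dvd i" using ord_pos[OF y] by (simp add: mult.commute)
  moreover have "\<exists>u::nat. c [^] d = y [^] u"
  proof (cases "j = 0")
    case True
    then have "d = ord c" by (simp add: d_def)
    then show ?thesis using c y by (intro exI[of _ 0]) simp
  next
    case False
    then obtain u v where "j * u = ord c * v + d" using bezout_nat unfolding d_def by blast
    then have "y [^] u = c [^] (ord c * v + d)" using c by (simp add: j nat_pow_pow)
    also have "\<dots> = c [^] d" using c by (intro pow_eq_mod) auto
    finally show ?thesis by (intro exI[of _ u]) simp
  qed
  then obtain u :: nat where "c [^] d = y [^] u" by blast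
  moreover obtain e where "i = d * e" using \<open>d dvd i\<close> by blast
  ultimately have "x = y [^] (u * e)"
    unfolding i by (simp add: nat_pow_pow[OF c, symmetric]) (simp add: nat_pow_pow[OF y])
  then show ?thesis using y by (auto simp: mem_cyc_iff)
qed

lemma inj_on_pow:
  assumes "coprime k (card (carrier G))"
  shows "inj_on (\<lambda>h. h [^] k) (carrier G)"
proof (cases "k = 0")
  case True
  then have "card (carrier G) = 1" using assms by simp
  then obtain a where "carrier G = {a}" by (rule card_1_singletonE)
  then show ?thesis by simp
next
  case False
  then obtain i j where "k * i = card (carrier G) * j + 1" using nat_inverse_mod assms by blast
  then have e: "k * i = Coset.order G * j + 1" by (simp add: Coset.order_def)
  have *: "(h [^] k) [^] i = h" if h: "h \<in> carrier G" for h
  proof -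
    have "(h [^] k) [^] i = (h [^] Coset.order G) [^] j \<otimes> h"
      using h by (simp add: nat_pow_pow e)
    then show ?thesis using h by (simp add: pow_order_eq_1)
  qed
  show ?thesis by (rule inj_on_inverseI[of _ "\<lambda>h. h [^] i"]) (rule *)
qed

text \<open>
  Write \<open>x = y\<^sup>k\<close>. The exponent \<open>k\<close> is prime to \<open>ord y\<close> and may be changed modulo \<open>ord y\<close> to be prime
  to \<open>|G|\<close>; then \<open>h \<mapsto> h\<^sup>k\<close> is injective and sends roots of \<open>y\<close> to roots of \<open>x\<close>.
\<close>

lemma num_roots_le_generator:
  assumes y: "y \<in> carrier G" and xy: "x \<in> cyc y" and o: "ord x = ord y"
  shows "num_roots G l y \<le> num_roots G l x"
proof -
  obtain k :: nat where k: "x = y [^] k" using y xy by (auto simp: mem_cyc_iff)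
  then have "coprime k (ord y)" using pow_ord_eq_ord_iff[OF finite_carrier y] o by simp
  then obtain t where t: "coprime (k + ord y * t) (card (carrier G))"
    using coprime_shift finite_carrier y by (metis card_gt_0_iff empty_iff)
  let ?k = "k + ord y * t"
  have x: "x = y [^] ?k" unfolding k using y by (intro pow_eq_mod) auto
  have "(h [^] ?k) [^] l = x" if "h \<in> carrier G" "h [^] l = y" for h
    using that x by (metis nat_pow_pow mult.commute)
  then have "(\<lambda>h. h [^] ?k) ` {h \<in> carrier G. h [^] l = y} \<subseteq> {h \<in> carrier G. h [^] l = x}" by auto
  then show ?thesis unfolding num_roots_def
    using inj_on_subset[OF inj_on_pow[OF t]] finite_carrier
    by (intro card_inj_on_le[of "\<lambda>h. h [^] ?k"]) auto
qed

lemma num_roots_le_in_cyc: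
  assumes "c \<in> carrier G" "x \<in> cyc c" "y \<in> cyc c" "ord x = ord y"
  shows "num_roots G l y \<le> num_roots G l x"
proof (rule num_roots_le_generator)
  show "y \<in> carrier G" using assms subgroup.mem_carrier[OF subgroup_cyc] by blast
  show "x \<in> cyc y" using same_ord_in_cyc assms by blast
qed (fact assms)

lemma conj_pow:
  assumes "g \<in> carrier G" "h \<in> carrier G"
  shows "(g \<otimes> h \<otimes> inv g) [^] (k::nat) = g \<otimes> h [^] k \<otimes> inv g"
proof (induction k)
  case (Suc k)
  have "inv g \<otimes> (g \<otimes> (h \<otimes> inv g)) = h \<otimes> inv g"
    using assms by (simp flip: m_assoc)
  then have "g \<otimes> h [^] k \<otimes> inv g \<otimes> (g \<otimes> h \<otimes> inv g) = g \<otimes> (h [^] k \<otimes> h) \<otimes> inv g"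
    using assms by (simp add: m_assoc)
  then show ?case using Suc by simp
qed (use assms in simp)

lemma conj_inj: "g \<in> carrier G \<Longrightarrow> inj_on (\<lambda>h. g \<otimes> h \<otimes> inv g) (carrier G)"
  by (auto simp: inj_on_def)

lemma ord_conj:
  assumes "g \<in> carrier G" "h \<in> carrier G"
  shows "ord (g \<otimes> h \<otimes> inv g) = ord h"
proof -
  have "(g \<otimes> h [^] k \<otimes> inv g = \<one>) \<longleftrightarrow> h [^] k = \<one>" for k :: nat
    using inj_onD[OF conj_inj[OF assms(1)], of "h [^] k" \<one>] assms by auto
  then show ?thesis using assms by (simp add: ord_unique conj_pow pow_eq_id)
qed

lemma num_roots_conj_le:
  assumes g: "g \<in> carrier G" and x: "x \<in> carrier G"
  shows "num_roots G l (g \<otimes> x \<otimes> inv g) \<ge> num_roots G l x"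
  unfolding num_roots_def using assms finite_carrier inj_on_subset[OF conj_inj[OF g]]
  by (intro card_inj_on_le[of "\<lambda>h. g \<otimes> h \<otimes> inv g"]) (auto simp: conj_pow)


section \<open>Cosets of subgroups of prime order\<close>

lemma prime_cyc_mem:
  assumes z: "z \<in> carrier G" "Factorial_Ring.prime (ord z)"
    and w: "w \<in> cyc z" "w \<noteq> \<one>" and N: "subgroup N G" "w \<in> N"
  shows "z \<in> N"
proof -
  have wc: "w \<in> carrier G" using N by (rule subgroup.mem_carrier)
  have "ord w dvd ord z" using ord_dvd_subgroup[OF subgroup_cyc[OF z(1)] w(1)] card_cyc[OF z(1)] by simp
  moreover have "ord w \<noteq> 1" using ord_eq_1[OF wc] w by simp
  ultimately have "ord w = ord z" using z(2) by (metis prime_nat_iff)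
  then have "z \<in> cyc w" using same_ord_in_cyc[OF z(1) self_in_cyc w(1)] by simp
  then show ?thesis using cyc_subset[OF N(2,1)] by blast
qed

lemma inj_on_subgroup_mult:
  assumes H: "subgroup H G" and K: "subgroup K G" and HK: "H \<inter> K = {\<one>}"
  shows "inj_on (\<lambda>(h, k). h \<otimes> k) (H \<times> K)"
proof (rule inj_onI, clarify)
  fix h k h' k' assume m: "h \<in> H" "h' \<in> H" "k \<in> K" "k' \<in> K" and e: "h \<otimes> k = h' \<otimes> k'"
  have c: "h \<in> carrier G" "h' \<in> carrier G" "k \<in> carrier G" "k' \<in> carrier G"
    using m subgroup.mem_carrier[OF H] subgroup.mem_carrier[OF K] by simp_all
  have "inv h' \<otimes> h = inv h' \<otimes> (h \<otimes> k) \<otimes> inv k" using c by (simp add: m_assoc)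
  also have "\<dots> = k' \<otimes> inv k" using c by (simp add: e) (simp flip: m_assoc)
  finally have q: "inv h' \<otimes> h = k' \<otimes> inv k" .
  have "inv h' \<otimes> h \<in> H" "k' \<otimes> inv k \<in> K"
    using m H K by (auto intro: subgroup.m_closed subgroup.m_inv_closed)
  with q HK have "inv h' \<otimes> h = \<one>" by auto
  then have hh: "h = h'" using c by (metis inv_equality inv_inv inv_closed)
  moreover have "k = k'" using e c by (simp add: hh)
  ultimately show "h = h' \<and> k = k'" by simp
qed

lemma prime_cyc_inter:
  assumes z: "z \<in> carrier G" "Factorial_Ring.prime (ord z)" and N: "subgroup N G" "z \<notin> N"
  shows "cyc z \<inter> N = {\<one>}"
  using prime_cyc_mem[OF z] N subgroup.one_closed[OF subgroup_cyc[OF z(1)]] subgroup.one_closed[OF N(1)]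
  by blast

text \<open>
  The \<open>p\<close> powers of \<open>z\<close> lie in different cosets of \<open>N\<close>, so the index is at least \<open>p\<close>. It is not \<open>p\<close>,
  since \<open>p\<close> divides \<open>|N|\<close> but \<open>p\<^sup>2\<close> does not divide \<open>|H|\<close>. This replaces an appeal to the number of
  Sylow subgroups.
\<close>

lemma index_ge_Suc_prime:
  assumes H: "subgroup H G" and N: "subgroup N G" "N \<subseteq> H"
    and z: "z \<in> H" "z \<notin> N" "ord z = p" and p: "Factorial_Ring.prime p"
    and dvd: "p dvd card N" "\<not> p ^ 2 dvd card H"
  shows "(p + 1) * card N \<le> card H"
proof -
  have zc: "z \<in> carrier G" using H z(1) by (rule subgroup.mem_carrier)
  have inj: "inj_on (\<lambda>(h, k). h \<otimes> k) (cyc z \<times> N)"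
    using inj_on_subgroup_mult[OF subgroup_cyc[OF zc] N(1)] prime_cyc_inter[OF zc _ N(1)] z p by blast
  have "(\<lambda>(h, k). h \<otimes> k) ` (cyc z \<times> N) \<subseteq> H"
    using cyc_subset[OF z(1) H] N(2) H by (auto intro: subgroup.m_closed)
  from card_inj_on_le[OF inj this finite_subgroup[OF H]]
  have le: "p * card N \<le> card H" using card_cyc[OF zc] z(3) by (simp add: card_cartesian_product)
  obtain k where k: "card H = card N * k" using subgroup_card_dvd[OF N(1) H N(2)] by blast
  have "k \<noteq> p" using dvd k by (auto simp: power2_eq_square)
  moreover have "p \<le> k" using le k subgroup_card_pos[OF N(1)] by simp
  ultimately show ?thesis using k by (metis Suc_eq_plus1 mult.commute mult_le_mono1 nat_less_le Suc_leI)
qed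

lemma pow_commute:
  fixes i j :: nat
  assumes "a \<in> carrier G" "b \<in> carrier G" "a \<otimes> b = b \<otimes> a"
  shows "a [^] i \<otimes> b [^] j = b [^] j \<otimes> a [^] i"
  using group_commutes_pow[of a "b [^] j" i] group_commutes_pow[of b a j] assms by simp

text \<open>
  The products of powers of \<open>z\<close> and \<open>w\<close> form a subgroup of order \<open>p\<^sup>2\<close>.
\<close>

lemma commuting_prime_square_dvd:
  assumes p: "Factorial_Ring.prime p" and z: "z \<in> carrier G" "ord z = p"
    and w: "w \<in> carrier G" "ord w = p" "w \<notin> cyc z" and c: "z \<otimes> w = w \<otimes> z"
  shows "p ^ 2 dvd card (carrier G)"
proof -
  have comm: "u \<otimes> v = v \<otimes> u" if "u \<in> cyc z" "v \<in> cyc w" for u v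
    using that pow_commute[OF z(1) w(1) c] mem_cyc_iff z w by metis
  let ?U = "(\<lambda>(h, k). h \<otimes> k) ` (cyc z \<times> cyc w)"
  note sub = subgroup_cyc[OF z(1)] subgroup_cyc[OF w(1)]
  note car = subgroup.mem_carrier[OF sub(1)] subgroup.mem_carrier[OF sub(2)]
  have "subgroup ?U G"
  proof (rule subgroupI)
    show "?U \<subseteq> carrier G" using car by auto
    show "?U \<noteq> {}" using self_in_cyc by blast
  next
    fix a assume "a \<in> ?U"
    then obtain u v where uv: "a = u \<otimes> v" "u \<in> cyc z" "v \<in> cyc w" by auto
    have "inv a = inv u \<otimes> inv v"
      using uv car comm[OF uv(2,3)] by (simp add: inv_mult_group)
    then show "inv a \<in> ?U" using uv sub by (auto intro!: subgroup.m_inv_closed rev_image_eqI[of "(inv u, inv v)"])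
  next
    fix a b assume "a \<in> ?U" "b \<in> ?U"
    then obtain u v s t where uv: "a = u \<otimes> v" "u \<in> cyc z" "v \<in> cyc w"
      and st: "b = s \<otimes> t" "s \<in> cyc z" "t \<in> cyc w" by auto
    have "a \<otimes> b = u \<otimes> (v \<otimes> s) \<otimes> t" using uv st car by (simp add: m_assoc)
    also have "\<dots> = (u \<otimes> s) \<otimes> (v \<otimes> t)" using uv st car by (simp flip: comm) (simp add: m_assoc)
    finally show "a \<otimes> b \<in> ?U" using uv st sub
      by (auto intro!: subgroup.m_closed rev_image_eqI[of "(u \<otimes> s, v \<otimes> t)"])
  qed
  moreover have "cyc z \<inter> cyc w = {\<one>}"
    using prime_cyc_inter[OF w(1) _ sub(1) w(3)] w(2) p by blast
  then have "card ?U = p ^ 2"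
    using card_image[OF inj_on_subgroup_mult[OF sub]] card_cyc z w
    by (simp add: card_cartesian_product power2_eq_square)
  ultimately show ?thesis using subgroup_card_dvd_order by metis
qed

text \<open>
  A conjugate of \<open>x\<close> in \<open>B\<close> is a fixed coset for \<open>x\<close> acting on the cosets of \<open>B\<close>. Without one,
  every orbit has the full prime length \<open>ord x\<close>; in terms of elements, \<open>G\<close> is a disjoint union of
  double cosets \<open>B g \<langle>x\<rangle>\<close> of size \<open>|B| ord x\<close>.
\<close>

lemma conj_in_subgroup_or_dvd:
  assumes B: "subgroup B G" and x: "x \<in> carrier G" "Factorial_Ring.prime (ord x)"
    and none: "\<And>g. g \<in> carrier G \<Longrightarrow> g \<otimes> x \<otimes> inv g \<notin> B"
  shows "ord x * card B dvd card (carrier G)"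
proof (rule card_dvd_of_blocks[OF finite_carrier])
  let ?blk = "\<lambda>g. (\<lambda>(b, u). b \<otimes> g \<otimes> u) ` (B \<times> cyc x)"
  note sub = subgroup_cyc[OF x(1)]
  note car = subgroup.mem_carrier[OF B] subgroup.mem_carrier[OF sub]
  fix g assume g: "g \<in> carrier G"
  have inj: "inj_on (\<lambda>(b, u). b \<otimes> g \<otimes> u) (B \<times> cyc x)"
  proof (rule inj_onI, clarify)
    fix b u b' u' assume m: "b \<in> B" "b' \<in> B" "u \<in> cyc x" "u' \<in> cyc x"
      and e: "b \<otimes> g \<otimes> u = b' \<otimes> g \<otimes> u'"
    note cc = car(1)[OF m(1)] car(1)[OF m(2)] car(2)[OF m(3)] car(2)[OF m(4)] g
    \<comment> \<open>Two equal products yield a power of \<open>x\<close> that \<open>g\<close> conjugates into \<open>B\<close>; if it were not trivial, \<open>x\<close> would be a power of it.\<close>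
    have "g \<otimes> (u \<otimes> inv u') \<otimes> inv g = inv b \<otimes> (b \<otimes> g \<otimes> u) \<otimes> inv u' \<otimes> inv g"
      using cc by (simp add: m_assoc[symmetric])
    also have "\<dots> = inv b \<otimes> b'" unfolding e using cc by (simp add: m_assoc)
    finally have "g \<otimes> (u \<otimes> inv u') \<otimes> inv g = inv b \<otimes> b'" .
    then have inB: "g \<otimes> (u \<otimes> inv u') \<otimes> inv g \<in> B"
      using m B by (simp add: subgroup.m_closed subgroup.m_inv_closed)
    have w: "u \<otimes> inv u' \<in> cyc x" using m sub by (simp add: subgroup.m_closed subgroup.m_inv_closed)
    have "u \<otimes> inv u' = \<one>"
    proof (rule ccontr)
      assume "u \<otimes> inv u' \<noteq> \<one>"
      then have "x \<in> cyc (u \<otimes> inv u')"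
        using prime_cyc_mem[OF x w _ subgroup_cyc self_in_cyc] car(2)[OF w] by blast
      then obtain k :: nat where "x = (u \<otimes> inv u') [^] k" using car(2)[OF w] by (auto simp: mem_cyc_iff)
      then have "g \<otimes> x \<otimes> inv g = (g \<otimes> (u \<otimes> inv u') \<otimes> inv g) [^] k"
        using conj_pow[OF g] cc by simp
      then have "g \<otimes> x \<otimes> inv g \<in> B" using subgroup_pow_closed[OF B inB] by simp
      with none g show False by blast
    qed
    then have uu: "u = u'" using cc by (metis inv_equality inv_inv inv_closed)
    moreover have "b = b'" using e cc by (simp add: uu m_assoc)
    ultimately show "b = b' \<and> u = u'" by simp
  qed
  have "g \<in> ?blk g" using g subgroup.one_closed[OF B] subgroup.one_closed[OF sub]
    by (auto intro!: rev_image_eqI[of "(\<one>, \<one>)"])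
  moreover have "?blk g \<subseteq> carrier G" using g car by auto
  moreover have "card (?blk g) = ord x * card B"
    using card_image[OF inj] card_cyc[OF x(1)] by (simp add: card_cartesian_product)
  ultimately show "g \<in> ?blk g \<and> ?blk g \<subseteq> carrier G \<and> card (?blk g) = ord x * card B" by blast
  fix h assume "h \<in> ?blk g"
  then obtain b u where h: "h = b \<otimes> g \<otimes> u" "b \<in> B" "u \<in> cyc x" by auto
  have one: "?blk (b \<otimes> g \<otimes> u) \<subseteq> ?blk g" if "b \<in> B" "u \<in> cyc x" "g \<in> carrier G" for b u g
  proof clarify
    fix c v assume cv: "c \<in> B" "v \<in> cyc x"
    have "c \<otimes> (b \<otimes> g \<otimes> u) \<otimes> v = (c \<otimes> b) \<otimes> g \<otimes> (u \<otimes> v)"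
      using that cv car by (simp add: m_assoc)
    then show "c \<otimes> (b \<otimes> g \<otimes> u) \<otimes> v \<in> ?blk g"
      using that cv B sub by (auto intro!: rev_image_eqI[of "(c \<otimes> b, u \<otimes> v)"] subgroup.m_closed)
  qed
  have "g = inv b \<otimes> h \<otimes> inv u" using h g car by (simp add: m_assoc) (simp add: m_assoc[symmetric])
  then have "?blk g \<subseteq> ?blk h"
    using one[of "inv b" "inv u" h] h g car B sub by (simp add: subgroup.m_inv_closed)
  moreover have "?blk h \<subseteq> ?blk g" using one h g by simp
  ultimately show "?blk h = ?blk g" by blast
qed

section \<open>The case where the prime divides the order of the elements\<close>

lemma ord_of_prime_root:
  assumes c: "c \<in> carrier G" and q: "Factorial_Ring.prime q" and d: "q dvd ord (c [^] q)"
  shows "ord c = q * ord (c [^] q)"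
proof -
  have q0: "q \<noteq> 0" using q by auto
  have e: "ord (c [^] q) = ord c div gcd (ord c) q" using ord_pow_gen[OF c, of q] q0 by simp
  then have "ord (c [^] q) dvd ord c" by (metis dvd_def dvd_div_mult_self gcd_dvd1)
  then have "q dvd ord c" using d dvd_trans by blast
  then have "gcd (ord c) q = q" by simp
  with e \<open>q dvd ord c\<close> show ?thesis by simp
qed

text \<open>
  Put \<open>n = ord y = pm\<close> and \<open>g = h\<^sup>2\<close>; both \<open>a\<close> and \<open>g\<close> have order \<open>pn\<close>. For even \<open>n\<close> the order \<open>2pn\<close> of \<open>h\<close>
  is at least \<open>4p\<^sup>2\<close>, so \<open>h\<close> generates \<open>G\<close>. For odd \<open>n\<close> let \<open>j\<close> be the order of \<open>a\<close> modulo \<open>\<langle>g\<rangle>\<close>.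
  Then \<open>j p n \<le> |G|\<close> gives \<open>j m < 8\<close>, while \<open>j\<close> divides \<open>p\<^sup>2m\<close>. As \<open>j\<close> and \<open>m\<close> are odd, \<open>j\<close>
  divides \<open>p\<close>, whence \<open>x = a\<^sup>p\<close> lies in \<open>\<langle>g\<rangle>\<close> with \<open>y\<close>.
\<close>

lemma num_roots_le_if_prime_dvd_ord:
  assumes p: "Factorial_Ring.prime p" "odd p" and small: "card (carrier G) < 8 * p ^ 2"
    and a: "a \<in> carrier G" "a [^] p = x" and h: "h \<in> carrier G" "h [^] (2 * p) = y"
    and o: "ord x = ord y" and d: "p dvd ord y"
  shows "num_roots G l y \<le> num_roots G l x"
proof -
  define g where "g = h [^] (2::nat)"
  have g: "g \<in> carrier G" "g [^] p = y" using h by (auto simp: g_def nat_pow_pow)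
  have og: "ord g = p * ord y" and oa: "ord a = p * ord y"
    using ord_of_prime_root[OF g(1) p(1)] ord_of_prime_root[OF a(1) p(1)] g a o d by auto
  have p3: "p \<ge> 3" using p prime_ge_2_nat[of p] by (cases "p = 2") auto
  show ?thesis
  proof (cases "even (ord y)")
    case True
    have oh: "ord h = 2 * (p * ord y)"
      using ord_of_prime_root[OF h(1), of 2] og True by (simp add: g_def)
    have "2 * p dvd ord y" using True d p by (metis divides_mult coprime_left_2_iff_odd)
    then obtain m where m: "ord y = 2 * p * m" by blast
    have "m > 0" using m ord_pos[OF g(1)] og by (cases m) auto
    then have ge: "4 * p ^ 2 \<le> ord h" using oh m by (simp add: power2_eq_square)
    have "cyc h = carrier G"
    proof (rule ccontr)
      assume "cyc h \<noteq> carrier G"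
      then have "cyc h \<subset> carrier G" using subgroup.subset[OF subgroup_cyc[OF h(1)]] by blast
      from subgroup_double[OF subgroup_cyc[OF h(1)] subgroup_self this]
      show False using card_cyc[OF h(1)] ge small by simp
    qed
    then show ?thesis using num_roots_le_in_cyc[OF h(1) _ _ o] a h by auto
  next
    case False
    obtain m where m: "ord y = p * m" using d by blast
    have m0: "odd m" using False m by simp
    define j where "j = (LEAST j. j > 0 \<and> a [^] (j::nat) \<in> cyc g)"
    have "ord a > 0 \<and> a [^] (ord a) \<in> cyc g"
      using ord_pos[OF a(1)] a subgroup.one_closed[OF subgroup_cyc[OF g(1)]] by simp
    then have j: "j > 0" "a [^] j \<in> cyc g" unfolding j_def by (metis (no_types, lifting) LeastI)+
    have jmin: "\<not> (i > 0 \<and> a [^] i \<in> cyc g)" if "i < j" for i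
      using not_less_Least that unfolding j_def by blast
    note sub = subgroup_cyc[OF g(1)]
    note car = subgroup.mem_carrier[OF sub]
    have diff: "i' \<le> i" if "i' < j" "u \<in> cyc g" "u' \<in> cyc g" "a [^] i \<otimes> u = a [^] i' \<otimes> u'" for i i' u u'
    proof (rule ccontr)
      assume "\<not> i' \<le> i"
      then have lt: "i < i'" by simp
      then have "a [^] i' = a [^] i \<otimes> a [^] (i' - i)" using a by (simp add: nat_pow_mult)
      then have "u = a [^] (i' - i) \<otimes> u'" using that car a by (simp add: m_assoc)
      then have "a [^] (i' - i) = u \<otimes> inv u'" using that car a by (simp add: m_assoc)
      then have "a [^] (i' - i) \<in> cyc g" using that sub by (simp add: subgroup.m_closed subgroup.m_inv_closed)
      moreover have "0 < i' - i" "i' - i < j" using lt that(1) by simp_all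
      ultimately show False using jmin[of "i' - i"] by blast
    qed
    have inj: "inj_on (\<lambda>(i, u). a [^] (i::nat) \<otimes> u) ({..<j} \<times> cyc g)"
    proof (rule inj_onI, clarify)
      fix i u i' u' assume m: "i < j" "i' < j" "u \<in> cyc g" "u' \<in> cyc g"
        and e: "a [^] i \<otimes> u = a [^] i' \<otimes> u'"
      have ii: "i = i'" using diff[of i' u u' i] diff[of i u' u i'] m e by simp
      moreover have "u = u'" using e m car a by (simp add: ii)
      ultimately show "i = i' \<and> u = u'" by simp
    qed
    have "(\<lambda>(i, u). a [^] (i::nat) \<otimes> u) ` ({..<j} \<times> cyc g) \<subseteq> carrier G"
      using car a by auto
    from card_inj_on_le[OF inj this finite_carrier] have "j * (p * ord y) \<le> card (carrier G)"
      using card_cyc[OF g(1)] og by (simp add: card_cartesian_product)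
    moreover have "j * (p * ord y) = (j * m) * p ^ 2" by (simp add: m power2_eq_square)
    ultimately have "(j * m) * p ^ 2 < 8 * p ^ 2" using small by linarith
    then have jm: "j * m < 8" using mult_less_cancel2 by blast
    have "j dvd ord a"
    proof -
      define r where "r = ord a mod j"
      have "a [^] (j * (ord a div j)) \<in> cyc g"
        using subgroup_pow_closed[OF sub j(2)] a by (simp add: nat_pow_pow)
      moreover have "a [^] (j * (ord a div j)) \<otimes> a [^] r = \<one>"
        using a by (simp add: nat_pow_mult r_def)
      ultimately have "a [^] r = inv (a [^] (j * (ord a div j)))" using a by (metis inv_equality inv_inv nat_pow_closed inv_closed)
      then have "a [^] r \<in> cyc g"
        using \<open>a [^] (j * (ord a div j)) \<in> cyc g\<close> sub by (simp add: subgroup.m_inv_closed)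
      moreover have "r < j" using j by (simp add: r_def)
      ultimately show ?thesis using jmin[of r] by (auto simp: r_def)
    qed
    then have jd: "j dvd p ^ 2 * m" using oa m by (simp add: power2_eq_square ac_simps)
    then have jo: "odd j" using m0 p by (meson dvd_trans even_mult_iff even_power)
    have "j dvd p"
    proof (cases "m = 1")
      case True
      then obtain i where i: "i \<le> 2" "j = p ^ i" using jd p(1) by (auto simp: divides_primepow_nat)
      have "p ^ 2 \<ge> 3 ^ 2" using p3 by (intro power_mono) auto
      then have "i \<noteq> 2" using jm True i by auto
      then have "i = 0 \<or> i = 1" using i by linarith
      then show ?thesis using i by auto
    next
      case False
      then have "m \<ge> 3" using m0 by presburger
      then have "j * 3 < 8" using jm by (meson le_less_trans mult_le_mono2)
      then have "j < 3" by simp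
      then have "j = 1" using jo j by (cases j) (auto simp: less_Suc_eq numeral_3_eq_3)
      then show ?thesis by simp
    qed
    then obtain e where "p = j * e" by blast
    then have "x = (a [^] j) [^] e" using a by (simp add: nat_pow_pow)
    then have "x \<in> cyc g" using subgroup_pow_closed[OF sub j(2)] by simp
    moreover have "y \<in> cyc g" using g mem_cyc_iff by blast
    ultimately show ?thesis using num_roots_le_in_cyc[OF g(1) _ _ o] by blast
  qed
qed

section \<open>Splitting off the part of order prime to p\<close>

definition roots :: "nat \<Rightarrow> 'a \<Rightarrow> 'a set" where
  "roots l g = {h \<in> carrier G. h [^] l = g}"

lemma num_roots_eq_card_roots: "num_roots G l g = card (roots l g)"
  by (simp add: num_roots_def roots_def)

lemma finite_roots: "finite (roots l g)"
  using finite_carrier by (simp add: roots_def)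

text \<open>
  An element \<open>h\<close> with \<open>h\<^sup>p\<^sup>m = g\<close> splits into \<open>a = h\<^sup>p\<close>, an \<open>m\<close>-th root of \<open>g\<close>, and its \<open>p\<close>-torsion
  part. With \<open>p i = 1\<close> modulo \<open>m ord g\<close> every such \<open>a\<close> satisfies \<open>a\<^sup>p\<^sup>i = a\<close>, so \<open>h\<close> is recovered
  as \<open>a\<^sup>i z\<close> with \<open>z = h\<^sup>1\<^sup>-\<^sup>p\<^sup>i\<close>.
\<close>

lemma num_roots_mult_coprime:
  assumes g: "g \<in> carrier G" and p: "coprime p (m * ord g)" "p > 0"
  shows "num_roots G (p * m) g = (\<Sum>a\<in>roots m g. card (roots p \<one> \<inter> centralizer a))"
proof -
  obtain i j where ij: "p * i = m * ord g * j + 1" using nat_inverse_mod p by blast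
  have red: "a [^] (p * i) = a" if "a \<in> roots m g" for a
  proof -
    have a: "a \<in> carrier G" "a [^] m = g" using that by (auto simp: roots_def)
    have "a [^] (p * i) = ((a [^] m) [^] ord g) [^] j \<otimes> a"
      using a(1) by (simp add: ij nat_pow_pow)
    then show ?thesis using a g by simp
  qed
  let ?S = "Sigma (roots m g) (\<lambda>a. roots p \<one> \<inter> centralizer a)"
  have fw: "(a [^] i \<otimes> z) [^] p = a \<and> a [^] i \<otimes> z \<in> carrier G"
    if "a \<in> roots m g" "z \<in> roots p \<one> \<inter> centralizer a" for a z
  proof -
    have c: "a \<in> carrier G" "z \<in> carrier G" "z [^] p = \<one>" "z \<otimes> a = a \<otimes> z"
      using that by (auto simp: roots_def centralizer_def)
    then have "(a [^] i \<otimes> z) [^] p = (a [^] i) [^] p \<otimes> z [^] p"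
      using group_commutes_pow[of a z i] by (intro pow_mult_distrib) auto
    then show ?thesis using c red[OF that(1)] by (simp add: nat_pow_pow mult.commute)
  qed
  have inv_fw: "inv ((a [^] i \<otimes> z) [^] (p * i)) \<otimes> (a [^] i \<otimes> z) = z"
    if az: "a \<in> roots m g" "z \<in> roots p \<one> \<inter> centralizer a" for a z
  proof -
    have c: "a \<in> carrier G" "z \<in> carrier G" using az by (auto simp: roots_def)
    have "(a [^] i \<otimes> z) [^] (p * i) = a [^] i" using fw[OF az] by (simp flip: nat_pow_pow)
    then show ?thesis using c by (simp flip: m_assoc)
  qed
  have bw: "h [^] p \<in> roots m g \<and> inv (h [^] (p * i)) \<otimes> h \<in> roots p \<one> \<inter> centralizer (h [^] p)"
    if "h \<in> roots (p * m) g" for h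
  proof -
      from that have h: "h \<in> carrier G" "h [^] (p * m) = g" by (auto simp: roots_def)
      have a: "h [^] p \<in> roots m g" using h by (simp add: roots_def nat_pow_pow)
      have k: "h [^] (p * i) \<otimes> h = h \<otimes> h [^] (p * i)" using group_commutes_pow[of h h] h by simp
      have inv_comm: "inv (h [^] (p * i)) \<otimes> h = h \<otimes> inv (h [^] (p * i))"
        using h k by (metis inv_closed m_closed nat_pow_closed inv_solve_left inv_solve_right m_assoc)
      have "(inv (h [^] (p * i)) \<otimes> h) [^] p = inv (h [^] (p * i)) [^] p \<otimes> h [^] p"
        using h inv_comm by (intro pow_mult_distrib) auto
      also have "\<dots> = inv ((h [^] p) [^] (p * i)) \<otimes> h [^] p"
        using h by (simp add: nat_pow_inv nat_pow_pow ac_simps)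
      also have "\<dots> = \<one>" using red[OF a] h by simp
      finally have "inv (h [^] (p * i)) \<otimes> h \<in> roots p \<one>" using h by (simp add: roots_def)
      moreover have "inv (h [^] (p * i)) \<otimes> h \<in> centralizer (h [^] p)"
      proof -
        have "h [^] (p * i) \<in> centralizer h" "h \<in> centralizer h" using h k by (auto simp: centralizer_def)
        then have "inv (h [^] (p * i)) \<otimes> h \<in> centralizer h"
          using subgroup_centralizer[OF h(1)] by (simp add: subgroup.m_closed subgroup.m_inv_closed)
        then show ?thesis using centralizer_pow_subset[OF h(1)] by blast
      qed
      ultimately show ?thesis using a by auto
  qed
  have "bij_betw (\<lambda>(a, z). a [^] i \<otimes> z) ?S (roots (p * m) g)"
  proof (rule bij_betw_byWitness[of _ "\<lambda>h. (h [^] p, inv (h [^] (p * i)) \<otimes> h)"])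
    show "\<forall>s\<in>?S. (\<lambda>h. (h [^] p, inv (h [^] (p * i)) \<otimes> h)) ((\<lambda>(a, z). a [^] i \<otimes> z) s) = s"
      using fw inv_fw by auto
    show "\<forall>h\<in>roots (p * m) g. (\<lambda>(a, z). a [^] i \<otimes> z) (h [^] p, inv (h [^] (p * i)) \<otimes> h) = h"
      by (auto simp: roots_def nat_pow_pow m_assoc[symmetric])
    show "(\<lambda>(a, z). a [^] i \<otimes> z) ` ?S \<subseteq> roots (p * m) g"
      using fw by (auto simp: roots_def nat_pow_pow[symmetric])
    show "(\<lambda>h. (h [^] p, inv (h [^] (p * i)) \<otimes> h)) ` roots (p * m) g \<subseteq> ?S"
      using bw by auto
  qed
  then have "card ?S = card (roots (p * m) g)" by (rule bij_betw_same_card)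
  then show ?thesis unfolding num_roots_eq_card_roots
    using finite_roots by (simp add: card_SigmaI)
qed


section \<open>Divisibility of numbers of roots\<close>

lemma card_dvd_right_mult:
  assumes H: "subgroup H G" and S: "S \<subseteq> carrier G"
    and closed: "\<And>s h. s \<in> S \<Longrightarrow> h \<in> H \<Longrightarrow> s \<otimes> h \<in> S"
  shows "card H dvd card S"
proof (rule card_dvd_of_blocks[where blk = "\<lambda>s. (\<lambda>h. s \<otimes> h) ` H"])
  note car = subgroup.mem_carrier[OF H]
  show "finite S" using S finite_carrier finite_subset by blast
  fix s assume s: "s \<in> S"
  then have sc: "s \<in> carrier G" using S by blast
  have "inj_on (\<lambda>h. s \<otimes> h) H" using sc car by (auto intro!: inj_onI)
  then show "s \<in> (\<lambda>h. s \<otimes> h) ` H \<and> (\<lambda>h. s \<otimes> h) ` H \<subseteq> S \<and> card ((\<lambda>h. s \<otimes> h) ` H) = card H"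
    using s sc closed subgroup.one_closed[OF H] by (auto simp: card_image intro!: rev_image_eqI[of \<one>])
  fix t assume "t \<in> (\<lambda>h. s \<otimes> h) ` H"
  then obtain k where t: "t = s \<otimes> k" "k \<in> H" by blast
  show "(\<lambda>h. t \<otimes> h) ` H = (\<lambda>h. s \<otimes> h) ` H"
  proof
    show "(\<lambda>h. t \<otimes> h) ` H \<subseteq> (\<lambda>h. s \<otimes> h) ` H"
      using t sc car by (auto simp: m_assoc intro!: imageI subgroup.m_closed[OF H])
    have "s \<otimes> h = t \<otimes> (inv k \<otimes> h)" if "h \<in> H" for h
      using t sc car[OF that] car[OF t(2)] by (simp add: m_assoc) (simp flip: m_assoc)
    then show "(\<lambda>h. s \<otimes> h) ` H \<subseteq> (\<lambda>h. t \<otimes> h) ` H"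
      using t(2) by (auto intro!: imageI subgroup.m_closed[OF H] subgroup.m_inv_closed[OF H])
  qed
qed

text \<open>
  Conjugation by \<open>u\<close> permutes the roots of \<open>g\<close>, and it acts freely on those that do not commute with
  \<open>u\<close> because \<open>u\<close> has prime order.
\<close>

lemma prime_dvd_noncommuting_roots:
  assumes g: "g \<in> carrier G" and u: "u \<in> centralizer g" "Factorial_Ring.prime (ord u)"
  shows "ord u dvd card (roots m g - centralizer u)"
proof (rule card_dvd_of_blocks)
  let ?blk = "\<lambda>a. (\<lambda>v. v \<otimes> a \<otimes> inv v) ` cyc u"
  have uc: "u \<in> carrier G" using u by (simp add: centralizer_def)
  note sub = subgroup_cyc[OF uc]
  note car = subgroup.mem_carrier[OF sub]
  have vg: "v \<otimes> g = g \<otimes> v" if "v \<in> cyc u" for v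
    using cyc_subset[OF u(1) subgroup_centralizer[OF g]] that by (auto simp: centralizer_def)
  have comm: "v \<otimes> u = u \<otimes> v" if "v \<in> cyc u" for v
    using cyc_subset[OF _ subgroup_centralizer[OF uc], of u] that uc by (auto simp: centralizer_def)
  have closed: "v \<otimes> a \<otimes> inv v \<in> roots m g - centralizer u"
    if "a \<in> roots m g - centralizer u" "v \<in> cyc u" for a v
  proof -
    have a: "a \<in> carrier G" "a [^] m = g" "a \<otimes> u \<noteq> u \<otimes> a" using that by (auto simp: roots_def centralizer_def)
    note v = car[OF that(2)]
    have "(v \<otimes> a \<otimes> inv v) [^] m = v \<otimes> g \<otimes> inv v" using conj_pow v a by simp
    also have "\<dots> = g" using vg[OF that(2)] g v by (simp add: m_assoc)
    finally have r: "v \<otimes> a \<otimes> inv v \<in> roots m g" using a v by (simp add: roots_def)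
    have "a \<otimes> u = u \<otimes> a" if c: "(v \<otimes> a \<otimes> inv v) \<otimes> u = u \<otimes> (v \<otimes> a \<otimes> inv v)"
    proof -
      have "inv v \<otimes> u = u \<otimes> inv v"
        using comm \<open>v \<in> cyc u\<close> sub by (simp add: subgroup.m_inv_closed)
      then have "v \<otimes> (a \<otimes> u) \<otimes> inv v = v \<otimes> (u \<otimes> a) \<otimes> inv v"
        using c comm[OF \<open>v \<in> cyc u\<close>] v a uc by (simp add: m_assoc) (metis m_assoc m_closed inv_closed)
      then show ?thesis using inj_onD[OF conj_inj[OF v]] a uc by (metis m_closed)
    qed
    with r a show ?thesis by (auto simp: centralizer_def)
  qed
  show "finite (roots m g - centralizer u)" using finite_roots by simp
  fix a assume a: "a \<in> roots m g - centralizer u"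
  then have ac: "a \<in> carrier G" "u \<notin> centralizer a" by (auto simp: roots_def centralizer_def)
  have "inj_on (\<lambda>v. v \<otimes> a \<otimes> inv v) (cyc u)"
  proof (rule inj_onI)
    fix v w assume vw: "v \<in> cyc u" "w \<in> cyc u" and e: "v \<otimes> a \<otimes> inv v = w \<otimes> a \<otimes> inv w"
    note c = car[OF vw(1)] car[OF vw(2)] ac(1)
    have "(inv w \<otimes> v) \<otimes> a = inv w \<otimes> (v \<otimes> a \<otimes> inv v) \<otimes> v" using c by (simp add: m_assoc)
    also have "\<dots> = a \<otimes> (inv w \<otimes> v)" unfolding e using c by (simp add: m_assoc) (simp flip: m_assoc)
    finally have "inv w \<otimes> v \<in> centralizer a" using c by (simp add: centralizer_def)
    moreover have "inv w \<otimes> v \<in> cyc u"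
      using vw sub by (simp add: subgroup.m_closed subgroup.m_inv_closed)
    ultimately have "inv w \<otimes> v = \<one>"
      using prime_cyc_inter[OF uc u(2) subgroup_centralizer[OF ac(1)] ac(2)] by blast
    then show "v = w" using c by (metis inv_closed inv_equality inv_inv)
  qed
  then have "card (?blk a) = ord u" using card_image card_cyc[OF uc] by metis
  moreover have "a \<in> ?blk a" using ac subgroup.one_closed[OF sub] by (auto intro!: rev_image_eqI[of \<one>])
  moreover have "?blk a \<subseteq> roots m g - centralizer u" using closed[OF a] by blast
  ultimately show "a \<in> ?blk a \<and> ?blk a \<subseteq> roots m g - centralizer u \<and> card (?blk a) = ord u" by blast
  have sub1: "?blk (v \<otimes> a \<otimes> inv v) \<subseteq> ?blk a" if "v \<in> cyc u" "a \<in> carrier G" for v a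
  proof clarify
    fix w assume w: "w \<in> cyc u"
    have "w \<otimes> (v \<otimes> a \<otimes> inv v) \<otimes> inv w = (w \<otimes> v) \<otimes> a \<otimes> inv (w \<otimes> v)"
      using that car w by (simp add: m_assoc inv_mult_group)
    then show "w \<otimes> (v \<otimes> a \<otimes> inv v) \<otimes> inv w \<in> ?blk a"
      using w that sub by (auto intro!: rev_image_eqI[of "w \<otimes> v"] subgroup.m_closed)
  qed
  fix b assume "b \<in> ?blk a"
  then obtain v where v: "v \<in> cyc u" "b = v \<otimes> a \<otimes> inv v" by blast
  have "a = inv v \<otimes> b \<otimes> inv (inv v)"
    using v ac car by (simp add: m_assoc) (simp add: m_assoc[symmetric])
  then have "?blk a \<subseteq> ?blk b"
    using sub1[of "inv v" b] v ac car sub by (simp add: subgroup.m_inv_closed)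
  moreover have "?blk b \<subseteq> ?blk a" using sub1[OF v(1) ac(1)] v(2) by simp
  ultimately show "?blk b = ?blk a" by blast
qed

text \<open>
  In the quotient of \<open>L\<close> by \<open>Z\<close> this bounds the number of \<open>t\<close> with \<open>t\<^sup>2 = 1\<close> if some \<open>x\<close> has
  \<open>x\<^sup>2 \<noteq> 1\<close>. If both \<open>h\<close> and \<open>hx\<close> square to \<open>1\<close>, then \<open>h\<close> inverts \<open>x\<close>. The elements inverting \<open>x\<close>
  are at most half of the group, as the product of two of them centralizes \<open>x\<close>, hence does not
  invert it. So a set of elements squaring to \<open>1\<close> meets its translate in at most half of the group
  and has at most three quarters of the elements.
\<close>

lemma card_squares_in_central_subgroup:
  assumes L: "subgroup L G" and Z: "subgroup Z G" "Z \<subseteq> L"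
    and central: "\<And>c h. c \<in> Z \<Longrightarrow> h \<in> L \<Longrightarrow> c \<otimes> h = h \<otimes> c"
    and x: "x \<in> L" "x \<otimes> x \<notin> Z"
  shows "4 * card {t \<in> L. t \<otimes> t \<in> Z} \<le> 3 * card L"
proof -
  note finL = finite_subgroup[OF L]
  note carL = subgroup.mem_carrier[OF L]
  have carZ: "c \<in> carrier G" if "c \<in> Z" for c using that Z carL by blast
  note closed = subgroup.m_closed[OF L] subgroup.m_inv_closed[OF L]
  define T where "T = {t \<in> L. t \<otimes> t \<in> Z}"
  define T' where "T' = {h \<in> L. h \<otimes> x \<in> T}"
  define E where "E = {h \<in> L. h \<otimes> x \<otimes> inv h \<otimes> x \<in> Z}"
  have TT: "T = (\<lambda>h. h \<otimes> x) ` T'"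
  proof
    show "T \<subseteq> (\<lambda>h. h \<otimes> x) ` T'"
    proof
      fix t assume t: "t \<in> T"
      then have tL: "t \<in> L" by (simp add: T_def)
      have "t = (t \<otimes> inv x) \<otimes> x" using carL[OF tL] carL[OF x(1)] by (simp add: m_assoc)
      moreover from this have "t \<otimes> inv x \<in> T'" using t tL x closed by (simp add: T'_def)
      ultimately show "t \<in> (\<lambda>h. h \<otimes> x) ` T'" by blast
    qed
  qed (auto simp: T'_def)
  have "finite T'" using finL by (simp add: T'_def)
  then have TT': "card T \<le> card T'" by (subst TT) (rule card_image_le)
  have "T \<inter> T' \<subseteq> E"
  proof
    fix h assume "h \<in> T \<inter> T'"
    then have h: "h \<in> L" "h \<otimes> h \<in> Z" "h \<otimes> x \<otimes> (h \<otimes> x) \<in> Z" by (auto simp: T_def T'_def)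
    note c = carL[OF h(1)] carL[OF x(1)]
    have "h \<otimes> x \<otimes> (h \<otimes> x) = h \<otimes> x \<otimes> inv h \<otimes> (h \<otimes> h \<otimes> x)" using c by (simp add: m_assoc) (simp add: m_assoc[symmetric])
    also have "h \<otimes> h \<otimes> x = x \<otimes> (h \<otimes> h)" using central[OF h(2) x(1)] .
    also have "h \<otimes> x \<otimes> inv h \<otimes> (x \<otimes> (h \<otimes> h)) = (h \<otimes> x \<otimes> inv h \<otimes> x) \<otimes> (h \<otimes> h)"
      using c by (simp add: m_assoc)
    finally have "h \<otimes> x \<otimes> inv h \<otimes> x = (h \<otimes> x \<otimes> (h \<otimes> x)) \<otimes> inv (h \<otimes> h)"
      using c by (simp add: inv_solve_right)
    also have "\<dots> \<in> Z" using h Z by (simp add: subgroup.m_closed subgroup.m_inv_closed)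
    finally show "h \<in> E" using h by (simp add: E_def)
  qed
  moreover have "card (T \<union> T') \<le> card L" using finL by (intro card_mono) (auto simp: T_def T'_def)
  moreover have "card T + card T' = card (T \<union> T') + card (T \<inter> T')"
    using finL by (intro card_Un_Int) (auto simp: T_def T'_def)
  moreover have "finite E" using finL by (simp add: E_def)
  ultimately have 1: "2 * card T \<le> card L + card E" using TT' card_mono[of E "T \<inter> T'"] by linarith
  have 2: "2 * card E \<le> card L"
  proof (cases "E = {}")
    case False
    then obtain k where k: "k \<in> E" by blast
    have "(\<lambda>h. k \<otimes> h) ` E \<subseteq> L - E"
    proof (rule image_subsetI, rule DiffI)
      fix h assume h: "h \<in> E"
      have kL: "k \<in> L" and hL: "h \<in> L" using h k by (auto simp: E_def)
      note c = carL[OF kL] carL[OF hL] carL[OF x(1)]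
      show "k \<otimes> h \<in> L" using kL hL closed by blast
      define p where "p = h \<otimes> x \<otimes> inv h \<otimes> x"
      define q where "q = k \<otimes> x \<otimes> inv k \<otimes> x"
      have pq: "p \<in> Z" "q \<in> Z" using h k by (auto simp: E_def p_def q_def)
      have hp: "h \<otimes> x \<otimes> inv h = p \<otimes> inv x" and kq: "k \<otimes> x \<otimes> inv k = q \<otimes> inv x"
        using c by (simp_all add: p_def q_def m_assoc)
      show "k \<otimes> h \<notin> E"
      proof
        assume "k \<otimes> h \<in> E"
        then have r: "(k \<otimes> h) \<otimes> x \<otimes> inv (k \<otimes> h) \<otimes> x \<in> Z" by (simp add: E_def)
        have "(k \<otimes> h) \<otimes> x \<otimes> inv (k \<otimes> h) = k \<otimes> (h \<otimes> x \<otimes> inv h) \<otimes> inv k"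
          using c by (simp add: m_assoc inv_mult_group)
        also have "\<dots> = k \<otimes> p \<otimes> inv x \<otimes> inv k" unfolding hp using c carZ[OF pq(1)] by (simp add: m_assoc)
        also have "k \<otimes> p = p \<otimes> k" using central[OF pq(1) kL] by simp
        also have "p \<otimes> k \<otimes> inv x \<otimes> inv k = p \<otimes> inv (k \<otimes> x \<otimes> inv k)"
          using c carZ[OF pq(1)] by (simp add: m_assoc inv_mult_group)
        also have "\<dots> = p \<otimes> (x \<otimes> inv q)" unfolding kq using c carZ[OF pq(2)] by (simp add: inv_mult_group)
        also have "x \<otimes> inv q = inv q \<otimes> x"
          using central[OF subgroup.m_inv_closed[OF Z(1) pq(2)] x(1)] by simp
        finally have "(k \<otimes> h) \<otimes> x \<otimes> inv (k \<otimes> h) \<otimes> x = p \<otimes> inv q \<otimes> (x \<otimes> x)"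
          using c carZ[OF pq(1)] carZ[OF pq(2)] by (simp add: m_assoc)
        then have "x \<otimes> x = inv (p \<otimes> inv q) \<otimes> ((k \<otimes> h) \<otimes> x \<otimes> inv (k \<otimes> h) \<otimes> x)"
          using c carZ[OF pq(1)] carZ[OF pq(2)] by (subst inv_solve_left) auto
        also have "\<dots> \<in> Z" using pq r Z by (simp add: subgroup.m_closed subgroup.m_inv_closed)
        finally show False using x by blast
      qed
    qed
    moreover have "inj_on (\<lambda>h. k \<otimes> h) E" using k carL by (auto intro!: inj_onI simp: E_def)
    ultimately have "card E \<le> card (L - E)" using finL by (metis card_inj_on_le finite_Diff)
    also have "\<dots> = card L - card E" using finL by (intro card_Diff_subset) (auto simp: E_def)
    finally show ?thesis using card_mono[of L E] finL by (auto simp: E_def)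
  qed simp
  show ?thesis using 1 2 unfolding T_def by linarith
qed

lemma subgroup_central_involution_roots:
  assumes L: "subgroup L G" and y: "y \<in> L" "y \<otimes> y = \<one>" "y \<noteq> \<one>"
    and central: "\<And>h. h \<in> L \<Longrightarrow> y \<otimes> h = h \<otimes> y"
    and x: "x \<in> L" "x \<otimes> x = \<one>" "x \<noteq> \<one>" "x \<noteq> y"
  shows "subgroup {\<one>, x, y, x \<otimes> y} G" "card {\<one>, x, y, x \<otimes> y} = 4"
proof -
  have c: "x \<in> carrier G" "y \<in> carrier G" using subgroup.mem_carrier[OF L] x y by auto
  have ext: "y \<otimes> (x \<otimes> u) = x \<otimes> (y \<otimes> u)" "x \<otimes> (x \<otimes> u) = u" "y \<otimes> (y \<otimes> u) = u" if "u \<in> carrier G" for u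
    using that c x y central[OF x(1)] by (metis m_assoc l_one)+
  have xy: "y \<otimes> x = x \<otimes> y" using central[OF x(1)] .
  have "inv x = x" "inv y = y" using c x y by (auto intro: inv_equality)
  then show "subgroup {\<one>, x, y, x \<otimes> y} G"
    using c x(2) y(2) xy ext by (intro subgroupI) (auto simp: inv_mult_group m_assoc)
  have "x \<otimes> y \<noteq> \<one>" using x y c by (metis inv_equality inv_unique' \<open>inv y = y\<close>)
  moreover have "x \<otimes> y \<noteq> x" "x \<otimes> y \<noteq> y" using x y c by auto
  ultimately show "card {\<one>, x, y, x \<otimes> y} = 4" using x y by auto
qed

lemma four_dvd_two_involutions:
  assumes fin: "finite S" and f: "\<And>s. s \<in> S \<Longrightarrow> f s \<in> S" "\<And>s. s \<in> S \<Longrightarrow> f (f s) = s"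
    and g: "\<And>s. s \<in> S \<Longrightarrow> g s \<in> S" "\<And>s. s \<in> S \<Longrightarrow> g (g s) = s"
    and fg: "\<And>s. s \<in> S \<Longrightarrow> f (g s) = g (f s)"
    and free: "\<And>s. s \<in> S \<Longrightarrow> f s \<noteq> s" "\<And>s. s \<in> S \<Longrightarrow> g s \<noteq> s" "\<And>s. s \<in> S \<Longrightarrow> f s \<noteq> g s"
  shows "4 dvd card S"
proof (rule card_dvd_of_blocks[OF fin, where blk = "\<lambda>s. {s, f s, g s, f (g s)}"])
  fix s assume s: "s \<in> S"
  have "f (g s) \<noteq> s" using free(3)[OF s] f(2)[OF g(1)[OF s]] by metis
  moreover have "f (g s) \<noteq> f s" using free(2)[OF s] f(2) s g(1) by metis
  moreover have "f (g s) \<noteq> g s" using free(1)[OF g(1)[OF s]] .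
  ultimately have "card {s, f s, g s, f (g s)} = 4" using free[OF s] by auto
  then show "s \<in> {s, f s, g s, f (g s)} \<and> {s, f s, g s, f (g s)} \<subseteq> S \<and> card {s, f s, g s, f (g s)} = 4"
    using s f g by auto
  fix t assume "t \<in> {s, f s, g s, f (g s)}"
  have e: "f (f s) = s" "g (g s) = s" "g (f s) = f (g s)" "f (f (g s)) = g s" "g (f (g s)) = f s"
    using f g s fg by metis+
  from \<open>t \<in> _\<close> consider "t = s" | "t = f s" | "t = g s" | "t = f (g s)" by blast
  then show "{t, f t, g t, f (g t)} = {s, f s, g s, f (g s)}"
  proof cases
    case 1 then show ?thesis by simp
  next
    case 2 then show ?thesis unfolding 2 e by blast
  next
    case 3 then show ?thesis unfolding 3 e by blast
  next
    case 4 then show ?thesis unfolding 4 e by blast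
  qed
qed

text \<open>
  Conjugation by \<open>t\<close> and multiplication by \<open>y\<close> are commuting involutions of \<open>S\<close>. The elements left
  out are those on which the first agrees with the identity or with the second.
\<close>

lemma four_dvd_non_twisted:
  assumes S: "S \<subseteq> carrier G" "\<And>s. s \<in> S \<Longrightarrow> inv t \<otimes> s \<otimes> t \<in> S" "\<And>s. s \<in> S \<Longrightarrow> s \<otimes> y \<in> S"
    and t: "t \<in> carrier G" "\<And>s. s \<in> S \<Longrightarrow> t \<otimes> t \<otimes> s = s \<otimes> (t \<otimes> t)"
    and y: "y \<in> carrier G" "y \<otimes> y = \<one>" "y \<noteq> \<one>" "y \<otimes> t = t \<otimes> y"
  shows "4 dvd card {s \<in> S. s \<otimes> t \<noteq> t \<otimes> s \<and> s \<otimes> t \<noteq> t \<otimes> s \<otimes> y}"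
proof (rule four_dvd_two_involutions[where f = "\<lambda>s. inv t \<otimes> s \<otimes> t" and g = "\<lambda>s. s \<otimes> y"])
  have it: "inv t \<otimes> s \<otimes> t = r \<longleftrightarrow> s \<otimes> t = t \<otimes> r" if "s \<in> carrier G" "r \<in> carrier G" for s r
    using that t by (metis inv_closed inv_solve_left m_assoc m_closed)
  have cj: "inv t \<otimes> (s \<otimes> y) \<otimes> t = inv t \<otimes> s \<otimes> t \<otimes> y" if "s \<in> carrier G" for s
    using that t y by (simp add: m_assoc)
  have inj: "inv t \<otimes> s \<otimes> t = inv t \<otimes> r \<otimes> t \<longleftrightarrow> s = r" if "s \<in> carrier G" "r \<in> carrier G" for s r
    using that t by auto
  let ?R = "{s \<in> S. s \<otimes> t \<noteq> t \<otimes> s \<and> s \<otimes> t \<noteq> t \<otimes> s \<otimes> y}"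
  have R: "s \<in> ?R \<longleftrightarrow> s \<in> S \<and> inv t \<otimes> s \<otimes> t \<noteq> s \<and> inv t \<otimes> s \<otimes> t \<noteq> s \<otimes> y" for s
  proof (cases "s \<in> S")
    case True
    then have "s \<in> carrier G" using S by blast
    then show ?thesis using it[of s s] it[of s "s \<otimes> y"] t y True by (simp add: m_assoc)
  qed simp
  show "finite ?R" using S finite_carrier finite_subset by (metis (no_types, lifting) mem_Collect_eq subsetI subset_trans)
  fix s assume s: "s \<in> ?R"
  then have sS: "s \<in> S" "s \<in> carrier G" using S by auto
  note s' = s[unfolded R]
  have sc: "inv t \<otimes> s \<otimes> t \<in> carrier G" using sS t by simp
  show "inv t \<otimes> s \<otimes> t \<noteq> s" "inv t \<otimes> s \<otimes> t \<noteq> s \<otimes> y" using s' by auto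
  show "s \<otimes> y \<noteq> s" using y sS by simp
  show "inv t \<otimes> s \<otimes> t \<in> ?R" unfolding R using s' S(2) sS sc y inj cj by (metis m_closed)
  show "s \<otimes> y \<in> ?R" unfolding R using s' S(3) sS sc y cj by (metis m_closed r_cancel)
  show "inv t \<otimes> (inv t \<otimes> s \<otimes> t) \<otimes> t = s"
  proof -
    have "inv t \<otimes> (inv t \<otimes> s \<otimes> t) \<otimes> t = inv (t \<otimes> t) \<otimes> (s \<otimes> (t \<otimes> t))"
      using sS t by (simp add: m_assoc inv_mult_group)
    also have "\<dots> = s" using t(2)[OF sS(1)] t(1) sS by (metis inv_closed l_inv l_one m_assoc m_closed)
    finally show ?thesis .
  qed
  show "s \<otimes> y \<otimes> y = s" using y sS by (simp add: m_assoc)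
  show "inv t \<otimes> (s \<otimes> y) \<otimes> t = inv t \<otimes> s \<otimes> t \<otimes> y" using cj sS by simp
qed

lemma card_split_three:
  assumes "finite A"
  shows "card {a \<in> A. P a} + card {a \<in> A. \<not> P a \<and> Q a} + card {a \<in> A. \<not> P a \<and> \<not> Q a} = card A"
proof -
  have "card {a \<in> A. P a} + card {a \<in> A. \<not> P a} = card A"
    using assms by (subst card_Un_disjoint[symmetric]) (auto intro: arg_cong[of _ _ card])
  moreover have "card {a \<in> A. \<not> P a \<and> Q a} + card {a \<in> A. \<not> P a \<and> \<not> Q a} = card {a \<in> A. \<not> P a}"
    using assms by (subst card_Un_disjoint[symmetric]) (auto intro: arg_cong[of _ _ card])
  ultimately show ?thesis by simp
qed

lemma four_dvd_if_mult_closed: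
  assumes S: "S \<subseteq> carrier G" and k: "k \<in> carrier G" "k \<otimes> k = y" "y \<otimes> y = \<one>" "y \<noteq> \<one>"
    and step: "\<And>s. s \<in> S \<Longrightarrow> s \<otimes> k \<in> S"
  shows "4 dvd card S"
proof -
  have k2: "k [^] (2::nat) = y" using k by (simp add: numeral_2_eq_2)
  have "k [^] (4::nat) = (k [^] (2::nat)) [^] (2::nat)" using k by (simp add: nat_pow_pow)
  also have "\<dots> = y \<otimes> y" using k(1) unfolding k2 k(2)[symmetric] by (simp add: numeral_2_eq_2)
  finally have "k [^] (4::nat) = \<one>" using k(3) by simp
  then have "ord k dvd 2 ^ 2" using k by (simp add: pow_eq_id)
  then obtain i where i: "i \<le> 2" "ord k = 2 ^ i" using divides_primepow_nat[OF two_is_prime_nat] by blast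
  have "\<not> ord k dvd 2" using k k2 by (metis pow_eq_id)
  then have "i = 2" using i by (cases i; cases "i - 1") auto
  then have o: "ord k = 4" using i by simp
  have pow: "s \<otimes> k [^] (i::nat) \<in> S" if "s \<in> S" for s i
  proof (induction i)
    case 0 then show ?case using that S by auto
  next
    case (Suc i)
    then show ?case using step[OF Suc] that S k by (auto simp: m_assoc subset_iff)
  qed
  have "card (cyc k) dvd card S"
    using pow mem_cyc_iff[OF k(1)] by (intro card_dvd_right_mult subgroup_cyc k S) auto
  then show ?thesis using card_cyc[OF k(1)] o by simp
qed

text \<open>
  The square roots \<open>h\<close> of \<open>y\<close> are sorted by how they commute with \<open>x\<close>, and the roots with
  \<open>hx = xhy\<close> moreover by how they commute with \<open>g\<close>. On each class some group of order four acts freely: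
  right multiplication by \<open>\<langle>x, y\<rangle>\<close> where \<open>hx = xh\<close>; by \<open>\<langle>gx\<rangle>\<close> where \<open>hx = xhy\<close> and \<open>hg = gh\<close>; by
  \<open>\<langle>g\<rangle>\<close> where \<open>hx = xhy\<close> and \<open>hg = ghy\<close>; and in the remaining classes conjugation by \<open>x\<close>, or
  by \<open>g\<close>, together with multiplication by \<open>y\<close>.
\<close>

lemma four_dvd_roots_of_central_involution:
  assumes L: "subgroup L G" and y: "y \<in> L" "y \<otimes> y = \<one>" "y \<noteq> \<one>"
    and central: "\<And>h. h \<in> L \<Longrightarrow> y \<otimes> h = h \<otimes> y"
    and x: "x \<in> L" "x \<otimes> x = \<one>" "x \<noteq> \<one>" "x \<noteq> y"
    and g: "g \<in> L" "g \<otimes> g = y" "x \<otimes> g = g \<otimes> x"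
  shows "4 dvd card {h \<in> L. h \<otimes> h = y}"
proof -
  define A where "A = {h \<in> L. h \<otimes> h = y}"
  note finL = finite_subgroup[OF L]
  note carL = subgroup.mem_carrier[OF L]
  note closed = subgroup.m_closed[OF L] subgroup.m_inv_closed[OF L]
  have c: "x \<in> carrier G" "y \<in> carrier G" "g \<in> carrier G" using carL x y g by auto
  have ext: "a \<otimes> (b \<otimes> u) = d \<otimes> u" if "a \<otimes> b = d" "a \<in> carrier G" "b \<in> carrier G" "u \<in> carrier G" for a b d u
    using that by (metis m_assoc)
  have yx: "y \<otimes> x = x \<otimes> y" and yg: "y \<otimes> g = g \<otimes> y" using central x g by auto
  \<comment> \<open>Rewriting to the normal form in which roots stand first and the letters \<open>g\<close>, \<open>x\<close>, \<open>y\<close> follow in this order.\<close>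
  note rules = c m_assoc x(2) y(2) g(2,3) yx yg
    ext[OF x(2)] ext[OF y(2)] ext[OF g(2)] ext[OF g(3)] ext[OF yx] ext[OF yg]
  define A0 where "A0 = {h \<in> A. h \<otimes> x = x \<otimes> h}"
  define A1 where "A1 = {h \<in> A. h \<otimes> x \<noteq> x \<otimes> h \<and> h \<otimes> x = x \<otimes> h \<otimes> y}"
  define A2 where "A2 = {h \<in> A. h \<otimes> x \<noteq> x \<otimes> h \<and> h \<otimes> x \<noteq> x \<otimes> h \<otimes> y}"
  define B0 where "B0 = {h \<in> A1. h \<otimes> g = g \<otimes> h}"
  define B1 where "B1 = {h \<in> A1. h \<otimes> g \<noteq> g \<otimes> h \<and> h \<otimes> g = g \<otimes> h \<otimes> y}"
  define B2 where "B2 = {h \<in> A1. h \<otimes> g \<noteq> g \<otimes> h \<and> h \<otimes> g \<noteq> g \<otimes> h \<otimes> y}"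
  have fA: "finite A" using finL by (simp add: A_def)
  have cA: "A \<subseteq> carrier G" using carL by (auto simp: A_def)
  note H = subgroup_central_involution_roots[OF L y central x]
  have ne: "x \<otimes> h \<otimes> y \<noteq> x \<otimes> h" if "h \<in> carrier G" for h using that c y by simp
  have "4 dvd card A0"
  proof -
    have "s \<otimes> h \<in> A0" if "s \<in> A0" "h \<in> {\<one>, x, y, x \<otimes> y}" for s h
    proof -
      have s: "s \<in> L" "s \<otimes> s = y" "s \<otimes> x = x \<otimes> s" using that by (auto simp: A0_def A_def)
      have ys: "y \<otimes> s = s \<otimes> y" using central s by simp
      note r = rules carL[OF s(1)] s(2) s(3)[symmetric] ys ext[OF s(2)] ext[OF s(3)[symmetric]] ext[OF ys]
      show ?thesis using that(2) s closed x y by (auto simp: A0_def A_def r)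
    qed
    then show ?thesis using card_dvd_right_mult[OF H(1), of A0] cA H(2) by (auto simp: A0_def)
  qed
  moreover have "4 dvd card A2"
    unfolding A2_def
  proof (rule four_dvd_non_twisted[OF cA _ _ c(1) _ c(2) y(2,3) yx])
    fix s assume "s \<in> A"
    then have s: "s \<in> L" "s \<otimes> s = y" by (auto simp: A_def)
    note sc = carL[OF s(1)]
    have ys: "y \<otimes> s = s \<otimes> y" using central s by simp
    have "(inv x \<otimes> s \<otimes> x) \<otimes> (inv x \<otimes> s \<otimes> x) = inv x \<otimes> (s \<otimes> s) \<otimes> x" using c sc by (simp add: m_assoc) (simp flip: m_assoc)
    also have "\<dots> = y" using c by (simp add: s m_assoc yx) (simp flip: m_assoc)
    finally show "inv x \<otimes> s \<otimes> x \<in> A" using s x closed by (simp add: A_def)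
    show "s \<otimes> y \<in> A" using s y closed sc by (simp add: A_def rules ys ext[OF ys] ext[OF s(2)])
    show "x \<otimes> x \<otimes> s = s \<otimes> (x \<otimes> x)" using sc x by simp
  qed
  moreover have "4 dvd card B2"
    unfolding B2_def
  proof (rule four_dvd_non_twisted[OF _ _ _ c(3) _ c(2) y(2,3) yg])
    show "A1 \<subseteq> carrier G" using cA by (auto simp: A1_def)
    fix s assume sA: "s \<in> A1"
    then have s: "s \<in> L" "s \<otimes> s = y" "s \<otimes> x = x \<otimes> s \<otimes> y" by (auto simp: A_def A1_def)
    note sc = carL[OF s(1)]
    have ys: "y \<otimes> s = s \<otimes> y" using central s by simp
    have xg: "inv g \<otimes> x = x \<otimes> inv g" using c g(3) by (metis inv_closed inv_solve_left inv_solve_right m_assoc m_closed)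
    have "(inv g \<otimes> s \<otimes> g) \<otimes> (inv g \<otimes> s \<otimes> g) = inv g \<otimes> (s \<otimes> s) \<otimes> g" using c sc by (simp add: m_assoc) (simp flip: m_assoc)
    also have "\<dots> = y" using c by (simp add: s m_assoc yg) (simp flip: m_assoc)
    finally have 1: "inv g \<otimes> s \<otimes> g \<in> A" using s g closed by (simp add: A_def)
    have "(inv g \<otimes> s \<otimes> g) \<otimes> x = inv g \<otimes> (s \<otimes> x) \<otimes> g" using c sc by (simp add: m_assoc g(3))
    also have "\<dots> = (inv g \<otimes> x) \<otimes> s \<otimes> (y \<otimes> g)" using c sc by (simp add: s m_assoc)
    also have "\<dots> = x \<otimes> (inv g \<otimes> s \<otimes> g) \<otimes> y" unfolding xg yg using c sc by (simp add: m_assoc)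
    finally have 2: "(inv g \<otimes> s \<otimes> g) \<otimes> x = x \<otimes> (inv g \<otimes> s \<otimes> g) \<otimes> y" .
    then show "inv g \<otimes> s \<otimes> g \<in> A1" using 1 ne[of "inv g \<otimes> s \<otimes> g"] c sc by (simp add: A1_def)
    have "s \<otimes> y \<in> A" using s y closed sc by (simp add: A_def rules ys ext[OF ys] ext[OF s(2)])
    moreover have "s \<otimes> y \<otimes> x = x \<otimes> (s \<otimes> y) \<otimes> y"
      using c sc s(3) by (simp add: m_assoc yx) (simp flip: m_assoc add: s(3))
    ultimately show "s \<otimes> y \<in> A1" using ne[of "s \<otimes> y"] c sc by (simp add: A1_def)
    show "g \<otimes> g \<otimes> s = s \<otimes> (g \<otimes> g)" using ys g by simp
  qed
  moreover have "4 dvd card B0"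
  proof -
    let ?k = "g \<otimes> x"
    have kk: "?k \<otimes> ?k = y" by (simp add: rules)
    have step: "s \<otimes> ?k \<in> B0" if "s \<in> B0" for s
    proof -
      have s: "s \<in> L" "s \<otimes> s = y" "s \<otimes> x = x \<otimes> s \<otimes> y" "s \<otimes> g = g \<otimes> s" using that by (auto simp: B0_def A1_def A_def)
      note sc = carL[OF s(1)]
      have ys: "y \<otimes> s = s \<otimes> y" using central s by simp
      have xs: "x \<otimes> s = s \<otimes> (x \<otimes> y)"
        using s(3) sc c by (metis m_assoc m_closed r_one y(2))
      note r = rules sc s(2) s(4)[symmetric] ys xs ext[OF s(2)] ext[OF s(4)[symmetric]] ext[OF ys] ext[OF xs]
      have "s \<otimes> ?k \<in> L" using s g x closed by simp
      then show ?thesis using ne[of "s \<otimes> ?k"] by (simp add: B0_def A1_def A_def r)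
    qed
    show ?thesis using step kk y cA c
      by (intro four_dvd_if_mult_closed[of _ ?k y]) (auto simp: B0_def A1_def)
  qed
  moreover have "4 dvd card B1"
  proof -
    have step: "s \<otimes> g \<in> B1" if "s \<in> B1" for s
    proof -
      have s: "s \<in> L" "s \<otimes> s = y" "s \<otimes> x = x \<otimes> s \<otimes> y" "s \<otimes> g = g \<otimes> s \<otimes> y" using that by (auto simp: B1_def A1_def A_def)
      note sc = carL[OF s(1)]
      have ys: "y \<otimes> s = s \<otimes> y" using central s by simp
      have xs: "x \<otimes> s = s \<otimes> (x \<otimes> y)"
        using s(3) sc c by (metis m_assoc m_closed r_one y(2))
      have gs: "g \<otimes> s = s \<otimes> (g \<otimes> y)"
        using s(4) sc c by (metis m_assoc m_closed r_one y(2))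
      note r = rules sc s(2) gs ys xs ext[OF s(2)] ext[OF gs] ext[OF ys] ext[OF xs]
      have "s \<otimes> g \<in> L" using s(1) g(1) by (rule closed)
      moreover have "g \<otimes> (s \<otimes> g) \<otimes> y \<noteq> g \<otimes> (s \<otimes> g)" using y(3) c sc by simp
      ultimately show ?thesis using ne[of "s \<otimes> g"] by (simp add: B1_def A1_def A_def r)
    qed
    show ?thesis using step y cA c g
      by (intro four_dvd_if_mult_closed[of _ g y]) (auto simp: B1_def A1_def)
  qed
  ultimately have "4 dvd card A0 + (card B0 + card B1 + card B2) + card A2" by simp
  also have "card B0 + card B1 + card B2 = card A1"
    unfolding B0_def B1_def B2_def using fA by (intro card_split_three) (simp add: A1_def)
  also have "card A0 + card A1 + card A2 = card A"
    unfolding A0_def A1_def A2_def using fA by (rule card_split_three)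
  finally show ?thesis by (simp add: A_def)
qed

end

section \<open>Elements of order prime to p: the setting\<close>

text \<open>
  The situation to be refuted when \<open>p\<close> does not divide \<open>n\<close>. The equality of the numbers of \<open>p\<close>-th
  roots and the inequality of the numbers of \<open>2p\<close>-th roots appear in the form given by
  \<open>num_roots_mult_coprime\<close>. Assumption \<open>not_conj_cyc\<close> holds because conjugate elements, and elements of
  equal order in a cyclic subgroup, have equally many roots.
\<close>

locale coprime_pair = finite_group +
  fixes p :: nat and x y :: 'a
  assumes prime_p: "Factorial_Ring.prime p" and odd_p: "odd p"
    and xG: "x \<in> carrier G" and yG: "y \<in> carrier G"
    and ord_eq: "ord x = ord y" and ndvd: "\<not> p dvd ord y"
    and sqrt_eq: "card (roots 2 x) = card (roots 2 y)"
    and tors_eq: "card (roots p \<one> \<inter> centralizer x) = card (roots p \<one> \<inter> centralizer y)"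
    and sum_less: "(\<Sum>a\<in>roots 2 x. card (roots p \<one> \<inter> centralizer a))
                 < (\<Sum>b\<in>roots 2 y. card (roots p \<one> \<inter> centralizer b))"
    and not_conj_cyc: "\<And>c g. c \<in> carrier G \<Longrightarrow> g \<in> carrier G \<Longrightarrow> g \<otimes> x \<otimes> inv g \<in> cyc c \<Longrightarrow> y \<notin> cyc c"
    and small: "card (carrier G) < 8 * p ^ 2"
begin

abbreviation tors :: "'a set" where "tors \<equiv> roots p \<one>"
abbreviation weight :: "'a \<Rightarrow> nat" where "weight a \<equiv> card (tors \<inter> centralizer a)"
abbreviation n :: nat where "n \<equiv> ord y"

lemma not_cyc: "c \<in> carrier G \<Longrightarrow> x \<in> cyc c \<Longrightarrow> y \<notin> cyc c"
  using not_conj_cyc[of c \<one>] xG by simp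

lemma p_ge_3: "p \<ge> 3"
  using prime_p odd_p prime_ge_2_nat[of p] by (cases "p = 2") auto

lemma n_ge_2: "n \<ge> 2"
proof (rule ccontr)
  assume "\<not> n \<ge> 2"
  then have "n = 1" using ord_pos[OF yG] by linarith
  then have "x = \<one>" "y = \<one>" using ord_eq_1 xG yG ord_eq by auto
  then show False using not_cyc[of \<one>] self_in_cyc[of \<one>] by auto
qed

lemma tors_nontriv:
  assumes "z \<in> tors" "z \<noteq> \<one>"
  shows "z \<in> carrier G" "ord z = p"
proof -
  show z: "z \<in> carrier G" using assms by (simp add: roots_def)
  have "ord z dvd p" using assms z pow_eq_id by (simp add: roots_def)
  then show "ord z = p" using prime_p assms z ord_eq_1 by (metis prime_nat_iff)
qed

lemma cyc_subset_tors: "z \<in> tors \<Longrightarrow> cyc z \<subseteq> tors"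
proof
  fix u assume z: "z \<in> tors" and u: "u \<in> cyc z"
  have zc: "z \<in> carrier G" "z [^] p = \<one>" using z by (auto simp: roots_def)
  obtain k :: nat where k: "u = z [^] k" using u zc mem_cyc_iff by blast
  have "u [^] p = (z [^] p) [^] k" using zc(1) by (simp add: k nat_pow_pow mult.commute)
  then show "u \<in> tors" using zc by (simp add: k roots_def)
qed

lemma weight_pos: "a \<in> carrier G \<Longrightarrow> weight a > 0"
  using finite_roots by (auto simp: card_gt_0_iff roots_def centralizer_def)

lemma root_centralizer_subset:
  assumes "a \<in> roots m g" shows "centralizer a \<subseteq> centralizer g" "a \<in> centralizer g"
proof -
  have a: "a \<in> carrier G" "g = a [^] m" using assms by (auto simp: roots_def)
  show "centralizer a \<subseteq> centralizer g" using centralizer_pow_subset a by simp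
  then show "a \<in> centralizer g" using a by (auto simp: centralizer_def)
qed

lemma root2: "a \<in> roots 2 g \<longleftrightarrow> a \<in> carrier G \<and> a \<otimes> a = g"
  by (auto simp: roots_def numeral_2_eq_2)

lemma half_pow:
  assumes g: "g \<in> carrier G" and o: "odd (ord g)"
  shows "(g [^] (2::nat)) [^] ((ord g + 1) div 2) = g" "(g [^] ((ord g + 1) div 2)) [^] (2::nat) = g"
proof -
  have e: "2 * ((ord g + 1) div 2) = ord g + 1" using o by simp
  have "g [^] (ord g + 1) = g" using g by simp
  then show "(g [^] (2::nat)) [^] ((ord g + 1) div 2) = g" "(g [^] ((ord g + 1) div 2)) [^] (2::nat) = g"
    using e g by (simp_all add: nat_pow_pow mult.commute)
qed

text \<open>
  A square root of \<open>g\<close> either doubles the order, or has odd order and is then the unique square root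
  of \<open>g\<close> in \<open>\<langle>g\<rangle>\<close>.
\<close>

lemma sqrt_ord:
  assumes b: "b \<in> roots 2 g"
  shows "ord b = 2 * ord g \<or> odd (ord g) \<and> b = g [^] ((ord g + 1) div 2)"
proof -
  have bc: "b \<in> carrier G" "b [^] (2::nat) = g" using b by (auto simp: roots_def)
  have o: "ord g = ord b div gcd (ord b) 2" using ord_pow_gen[OF bc(1), of 2] bc by simp
  show ?thesis
  proof (cases "even (ord b)")
    case True then show ?thesis using o by (simp add: gcd_nat.absorb2)
  next
    case False
    then have "gcd (ord b) 2 = 1" by (metis coprime_right_2_iff_odd coprime_iff_gcd_eq_1)
    then have "ord g = ord b" using o by simp
    then show ?thesis using half_pow[OF bc(1)] bc False by simp
  qed
qed

lemma weight_pow_sqrt: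
  assumes "g \<in> carrier G" "odd (ord g)"
  shows "g [^] ((ord g + 1) div 2) \<in> roots 2 g" "weight (g [^] ((ord g + 1) div 2)) = weight g"
proof -
  let ?h = "g [^] ((ord g + 1) div 2)"
  show r: "?h \<in> roots 2 g" using half_pow[OF assms] assms by (simp add: roots_def)
  have "centralizer ?h = centralizer g"
    using centralizer_pow_subset[OF assms(1)] root_centralizer_subset(1)[OF r] by blast
  then show "weight ?h = weight g" by simp
qed

text \<open>
  If all roots of order \<open>2n\<close> had weight \<open>1\<close>, the sum over the roots of \<open>y\<close> would be the smallest
  possible: the only other root, which exists for odd \<open>n\<close>, is a power of \<open>y\<close> and contributes
  \<open>f(y) = f(x)\<close>, exactly as the corresponding root of \<open>x\<close> does.
\<close>

lemma exists_witness: "\<exists>b \<in> roots 2 y. ord b = 2 * n \<and> weight b \<noteq> 1"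
proof (rule ccontr)
  assume neg: "\<not> ?thesis"
  have ge1: "weight a \<ge> 1" if "a \<in> roots 2 x" for a using weight_pos that by (force simp: roots_def)
  show False
  proof (cases "even n")
    case True
    then have "weight b = 1" if "b \<in> roots 2 y" for b using neg sqrt_ord that by blast
    then have "(\<Sum>b\<in>roots 2 y. weight b) = card (roots 2 x)" using sqrt_eq by simp
    also have "\<dots> \<le> (\<Sum>a\<in>roots 2 x. weight a)" using ge1 sum_mono[of "roots 2 x" "\<lambda>_. 1" weight] by simp
    finally show False using sum_less by simp
  next
    case False
    let ?e = "(n + 1) div 2"
    have ex: "x [^] ?e \<in> roots 2 x" "weight (x [^] ?e) = weight x"
      using weight_pow_sqrt[OF xG] ord_eq False by auto
    have ey: "y [^] ?e \<in> roots 2 y" "weight (y [^] ?e) = weight y"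
      using weight_pow_sqrt[OF yG] False by auto
    have "weight b = 1" if "b \<in> roots 2 y - {y [^] ?e}" for b using neg sqrt_ord that by blast
    then have "(\<Sum>b\<in>roots 2 y. weight b) = weight y + card (roots 2 y - {y [^] ?e})"
      using sum.remove[OF finite_roots ey(1), of weight] ey(2) by simp
    also have "\<dots> = weight x + card (roots 2 x - {x [^] ?e})" using tors_eq sqrt_eq ex(1) ey(1) finite_roots by simp
    also have "\<dots> \<le> weight x + (\<Sum>a\<in>roots 2 x - {x [^] ?e}. weight a)"
      using ge1 sum_mono[of "roots 2 x - {x [^] ?e}" "\<lambda>_. 1" weight] by simp
    also have "\<dots> = (\<Sum>a\<in>roots 2 x. weight a)"
      using sum.remove[OF finite_roots ex(1), of weight] ex(2) by simp
    finally show False using sum_less by simp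
  qed
qed

text \<open>
  Otherwise \<open>|G| = p\<^sup>2m\<close> with \<open>m < 8\<close> a multiple of the order \<open>2n\<close> of \<open>b\<close>, so \<open>m = 2n\<close> and \<open>n\<close> is \<open>2\<close>
  or \<open>3\<close>. The index \<open>p\<^sup>2\<close> of \<open>\<langle>b\<rangle>\<close> is prime to \<open>n\<close>, so some conjugate of \<open>x\<close> joins \<open>y\<close> in \<open>\<langle>b\<rangle>\<close>.
\<close>

lemma p_square_not_dvd: "\<not> p ^ 2 dvd card (carrier G)"
proof
  assume "p ^ 2 dvd card (carrier G)"
  then obtain m where m: "card (carrier G) = p ^ 2 * m" by blast
  obtain b where b: "b \<in> roots 2 y" "ord b = 2 * n" using exists_witness by blast
  have bc: "b \<in> carrier G" "b [^] (2::nat) = y" using b by (auto simp: roots_def)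
  have cop: "coprime (2 * n) (p ^ 2)"
    using prime_p odd_p ndvd by (metis coprime_commute coprime_power_right_iff even_mult_iff
        prime_dvd_mult_iff prime_imp_coprime_nat primes_dvd_imp_eq two_is_prime_nat dvd_refl)
  have "2 * n dvd p ^ 2 * m"
    using ord_dvd_subgroup[OF subgroup_self bc(1)] b m by simp
  then have "2 * n dvd m" using cop by (metis coprime_dvd_mult_right_iff)
  then obtain t where t: "m = 2 * n * t" by blast
  have "card (carrier G) > 0" using finite_carrier bc(1) card_gt_0_iff by blast
  then have "m \<noteq> 0" using m by (cases "m = 0") auto
  then have t0: "t \<ge> 1" using t by (cases t) auto
  have "p ^ 2 * m < p ^ 2 * 8" using small m by simp
  then have m8: "m < 8" using mult_less_cancel1 by blast
  have "2 * n * 1 \<le> 2 * n * t" using t0 by (intro mult_le_mono) auto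
  then have "n < 4" using m8 t by linarith
  then have n: "n = 2 \<or> n = 3" using n_ge_2 by linarith
  have "t = 1"
  proof (rule ccontr)
    assume "t \<noteq> 1"
    then have "2 * n * 2 \<le> 2 * n * t" using t0 by (intro mult_le_mono) auto
    then show False using m8 t n by linarith
  qed
  then have cG: "card (carrier G) = p ^ 2 * (2 * n)" using m t by simp
  have pn: "Factorial_Ring.prime (ord x)" using n unfolding ord_eq by (elim disjE) simp_all
  have yb: "y \<in> cyc b" using bc mem_cyc_iff by blast
  have "g \<otimes> x \<otimes> inv g \<notin> cyc b" if "g \<in> carrier G" for g using not_conj_cyc[OF bc(1) that] yb by blast
  then have "ord x * card (cyc b) dvd card (carrier G)"
    by (rule conj_in_subgroup_or_dvd[OF subgroup_cyc[OF bc(1)] xG pn])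
  then have "n * (2 * n) dvd p ^ 2 * (2 * n)" using card_cyc[OF bc(1)] b ord_eq cG by simp
  then have "n dvd p ^ 2" using n_ge_2 by simp
  then have "n dvd p" using pn ord_eq prime_dvd_power by metis
  then show False using ndvd prime_p pn ord_eq primes_dvd_imp_eq by metis
qed

lemma commuting_tors:
  assumes "u \<in> tors" "u \<noteq> \<one>" "w \<in> tors" "w \<in> centralizer u"
  shows "w \<in> cyc u"
proof (rule ccontr)
  assume w: "w \<notin> cyc u"
  note u = tors_nontriv[OF assms(1,2)]
  have "w \<noteq> \<one>" using w subgroup.one_closed[OF subgroup_cyc[OF u(1)]] by auto
  note w' = tors_nontriv[OF assms(3) this]
  have "u \<otimes> w = w \<otimes> u" using assms(4) by (simp add: centralizer_def)
  then show False
    using commuting_prime_square_dvd[OF prime_p u w' w] p_square_not_dvd by blast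
qed

text \<open>
  If the \<open>p\<close>-torsion of the centralizer of \<open>g\<close> is cyclic of order \<open>p\<close>, a square root of \<open>g\<close> commutes with
  all of it or only with \<open>1\<close>.
\<close>

lemma weight_of_root:
  assumes g: "g \<in> carrier G" and u: "u \<in> carrier G" "ord u = p" "tors \<inter> centralizer g = cyc u"
    and a: "a \<in> roots 2 g"
  shows "weight a = (if a \<in> centralizer u then p else 1)"
proof -
  have ac: "a \<in> carrier G" using a by (simp add: roots_def)
  have T: "tors \<inter> centralizer a = cyc u \<inter> centralizer a"
    using root_centralizer_subset(1)[OF a] u(3) by blast
  show ?thesis
  proof (cases "a \<in> centralizer u")
    case True
    then have "cyc u \<subseteq> centralizer a"
      using cyc_subset centralizer_sym subgroup_centralizer u ac by metis
    then show ?thesis using True T card_cyc[OF u(1)] u(2) by (simp add: Int_absorb2)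
  next
    case False
    then have "u \<notin> centralizer a" using centralizer_sym ac by blast
    then have "cyc u \<inter> centralizer a = {\<one>}"
      using prime_cyc_inter[OF u(1) _ subgroup_centralizer[OF ac]] u(2) prime_p by simp
    then show ?thesis using False T by simp
  qed
qed

lemma sum_weight:
  assumes "g \<in> carrier G" "u \<in> carrier G" "ord u = p" "tors \<inter> centralizer g = cyc u"
  shows "(\<Sum>a\<in>roots 2 g. weight a) = p * card (roots 2 g \<inter> centralizer u) + card (roots 2 g - centralizer u)"
proof -
  have "(\<Sum>a\<in>roots 2 g. weight a) = (\<Sum>a\<in>roots 2 g. if a \<in> centralizer u then p else 1)"
    using weight_of_root[OF assms] by (rule sum.cong[OF refl])
  also have "\<dots> = p * card (roots 2 g \<inter> centralizer u) + card (roots 2 g - centralizer u)"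
    using finite_roots by (simp add: sum.If_cases Diff_eq)
  finally show ?thesis .
qed

text \<open>
  Right multiplication by the involution of \<open>\<langle>g\<rangle>\<close> permutes these roots without fixed points.
\<close>

lemma even_commuting_roots:
  assumes g: "g \<in> carrier G" "even (ord g)" and u: "u \<in> centralizer g"
  shows "even (card (roots 2 g \<inter> centralizer u))"
proof -
  define t where "t = g [^] (ord g div 2)"
  have uc: "u \<in> carrier G" using u by (simp add: centralizer_def)
  have tc: "t \<in> carrier G" using g by (simp add: t_def)
  have "ord t = ord g div (ord g div 2)"
    unfolding t_def using g ord_pos[OF g(1)] by (intro ord_pow) auto
  also have "\<dots> = 2" using g(2) ord_pos[OF g(1)] by auto
  finally have ot: "ord t = 2" .
  have tt: "t \<otimes> t = \<one>" using pow_ord_eq_1[OF tc] tc by (simp add: ot numeral_2_eq_2)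
  have one: "s \<otimes> t \<in> roots 2 g \<inter> centralizer u" if s: "s \<in> roots 2 g \<inter> centralizer u" for s
  proof -
    have sc: "s \<in> carrier G" "s \<otimes> s = g" using s by (auto simp: root2)
    have "t \<in> centralizer s" using centralizer_sym centralizer_pow_subset[OF g(1)] root_centralizer_subset(2) s
        sc t_def tc by (metis IntD1 subsetD)
    then have st: "t \<otimes> s = s \<otimes> t" by (simp add: centralizer_def)
    have "s \<otimes> t \<otimes> (s \<otimes> t) = s \<otimes> (t \<otimes> s) \<otimes> t" using sc tc by (simp add: m_assoc)
    also have "\<dots> = s \<otimes> s \<otimes> (t \<otimes> t)" unfolding st using sc(1) tc by (simp add: m_assoc)
    finally have "s \<otimes> t \<in> roots 2 g" using sc tc tt by (simp add: root2 g(1))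
    moreover have "t \<in> centralizer u"
      unfolding t_def using subgroup_pow_closed[OF subgroup_centralizer[OF uc]] centralizer_sym[OF g(1) u] by blast
    ultimately show ?thesis using s subgroup_centralizer[OF uc] by (simp add: subgroup.m_closed)
  qed
  have "card (cyc t) dvd card (roots 2 g \<inter> centralizer u)"
  proof (rule card_dvd_right_mult[OF subgroup_cyc[OF tc]])
    show "roots 2 g \<inter> centralizer u \<subseteq> carrier G" by (auto simp: roots_def)
    fix s h assume s: "s \<in> roots 2 g \<inter> centralizer u" and "h \<in> cyc t"
    then obtain k :: nat where k: "h = t [^] k" using mem_cyc_iff[OF tc] by blast
    have "s \<otimes> t [^] k \<in> roots 2 g \<inter> centralizer u"
    proof (induction k)
      case 0 then show ?case using s by (auto simp: roots_def)
    next
      case (Suc k)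
      have "s \<in> carrier G" using s by (simp add: roots_def)
      then show ?case using one[OF Suc] tc by (simp add: m_assoc)
    qed
    then show "s \<otimes> h \<in> roots 2 g \<inter> centralizer u" by (simp add: k)
  qed
  then show ?thesis using card_cyc[OF tc] ot by simp
qed

end

section \<open>Elements of order prime to p: the contradiction\<close>

locale coprime_pair_witness = coprime_pair +
  fixes b z :: 'a
  assumes b: "b \<in> roots 2 y" "ord b = 2 * ord y"
    and z: "z \<in> roots p \<one>" "z \<noteq> \<one>" "z \<in> centralizer b"
begin

lemma bG: "b \<in> carrier G" using b by (simp add: roots_def)
lemmas zG = tors_nontriv(1)[OF z(1,2)]
lemmas ord_z = tors_nontriv(2)[OF z(1,2)]

text \<open>
  Lower bounds for the order of this subgroup drive the argument, until they exceed what \<open>|G|\<close> permits.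
\<close>

definition N :: "'a set" where "N = centralizer y \<inter> centralizer z"

lemma subgroup_N: "subgroup N G"
  unfolding N_def using subgroup_centralizer[OF yG] subgroup_centralizer[OF zG] by (rule subgroups_Inter_pair)

lemma mem_N: "b \<in> N" "z \<in> N" "y \<in> N"
proof -
  have "z \<in> centralizer y" using root_centralizer_subset(1)[OF b(1)] z(3) by blast
  moreover have "b \<in> centralizer y" using root_centralizer_subset(2)[OF b(1)] .
  ultimately show "b \<in> N" "z \<in> N" "y \<in> N"
    using centralizer_sym[OF yG] centralizer_sym[OF bG z(3)] yG zG by (auto simp: N_def centralizer_def)
qed

lemma y_mem: "y \<in> centralizer z" "z \<in> centralizer y" using mem_N by (auto simp: N_def)

lemma coprime_2n_p: "coprime (2 * n) p"
  using prime_p odd_p ndvd by (metis coprime_commute even_mult_iff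
        prime_dvd_mult_iff prime_imp_coprime_nat primes_dvd_imp_eq two_is_prime_nat dvd_refl)

lemma dvd_card_N: "2 * n * p dvd card N"
  using ord_dvd_subgroup[OF subgroup_N mem_N(1)] ord_dvd_subgroup[OF subgroup_N mem_N(2)]
  unfolding b(2) ord_z by (rule divides_mult[OF _ _ coprime_2n_p])

text \<open>
  The element \<open>bz\<close> generates a cyclic subgroup of order \<open>2np\<close> that contains \<open>y\<close>, hence not \<open>x\<close>.
\<close>

lemma N_proper:
  assumes "x \<in> N" shows "2 * (2 * n * p) \<le> card N"
proof -
  define c where "c = b \<otimes> z"
  have bz: "b \<otimes> z = z \<otimes> b" using z(3) by (simp add: centralizer_def)
  have c: "c \<in> carrier G" using bG zG by (simp add: c_def)
  have bc: "b \<in> cyc c" and zc: "z \<in> cyc c"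
  proof -
    obtain i j where ij: "p * i = 2 * n * j + 1"
      using nat_inverse_mod[of p "2 * n"] coprime_2n_p p_ge_3 by (auto simp: coprime_commute)
    have "c [^] (p * i) = b [^] (p * i) \<otimes> z [^] (p * i)"
      unfolding c_def using bz bG zG by (rule pow_mult_distrib)
    also have "z [^] (p * i) = \<one>" using zG ord_z by (simp add: pow_eq_id)
    also have "b [^] (p * i) = b"
      using bG pow_ord_eq_1[OF bG] by (simp add: ij b(2)[symmetric] nat_pow_pow[symmetric])
    finally have "b = c [^] (p * i)" using bG by simp
    then show *: "b \<in> cyc c" using mem_cyc_iff[OF c] by blast
    have "z = inv b \<otimes> c" using bG zG by (simp add: c_def flip: m_assoc)
    then show "z \<in> cyc c"
      using * self_in_cyc[of c] subgroup_cyc[OF c] by (simp add: subgroup.m_closed subgroup.m_inv_closed)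
  qed
  have "2 * n * p dvd card (cyc c)"
    using ord_dvd_subgroup[OF subgroup_cyc[OF c]] bc zc b ord_z coprime_2n_p by (metis divides_mult)
  then have le: "2 * n * p \<le> card (cyc c)" using dvd_imp_le subgroup_card_pos[OF subgroup_cyc[OF c]] by blast
  have "y = b [^] (2::nat)" using b(1) by (simp add: roots_def)
  then have "y \<in> cyc c" using subgroup_pow_closed[OF subgroup_cyc[OF c] bc] by simp
  then have "x \<notin> cyc c" using not_cyc[OF c] by blast
  moreover have "cyc c \<subseteq> N"
    using mem_N subgroup_N by (intro cyc_subset) (auto simp: c_def subgroup.m_closed)
  ultimately have "cyc c \<subset> N" using assms by blast
  from subgroup_double[OF subgroup_cyc[OF c] subgroup_N this] show ?thesis using le by linarith
qed

lemma not_p_square_dvd_subgroup: "subgroup H G \<Longrightarrow> \<not> p ^ 2 dvd card H"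
  using p_square_not_dvd dvd_trans[OF _ subgroup_card_dvd_order] by metis

text \<open>
  With a second subgroup of order \<open>p\<close>, \<open>C(y)\<close> has at least \<open>(p + 1) |N|\<close> elements, and \<open>2np\<close> divides
  \<open>|N|\<close>. The missing factor \<open>2\<close> for \<open>|G| \<ge> 8p(p + 1)\<close> comes from the index of \<open>C(y)\<close>, or, if \<open>y\<close> is central,
  from \<open>N\<close>: then \<open>f(x) = f(y)\<close> makes \<open>x\<close> commute with all \<open>p\<close>-torsion, so that \<open>x\<close> lies in \<open>N\<close>.
\<close>

lemma tors_inter_centralizer_y: "tors \<inter> centralizer y = cyc z"
proof
  show "cyc z \<subseteq> tors \<inter> centralizer y"
    using cyc_subset_tors[OF z(1)] cyc_subset[OF y_mem(2) subgroup_centralizer[OF yG]] by blast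
  show "tors \<inter> centralizer y \<subseteq> cyc z"
  proof (rule subsetI, rule ccontr)
    fix w assume w: "w \<in> tors \<inter> centralizer y" "w \<notin> cyc z"
    have wz: "w \<notin> centralizer z" using commuting_tors[OF z(1,2)] w by blast
    have "w \<noteq> \<one>" using w subgroup.one_closed[OF subgroup_cyc[OF zG]] by auto
    then have ow: "ord w = p" using tors_nontriv w by blast
    have "p dvd card N" using ord_dvd_subgroup[OF subgroup_N mem_N(2)] ord_z by simp
    then have ge: "(p + 1) * card N \<le> card (centralizer y)"
      using index_ge_Suc_prime[OF subgroup_centralizer[OF yG] subgroup_N _ _ _ ow prime_p]
        not_p_square_dvd_subgroup[OF subgroup_centralizer[OF yG]] w wz by (auto simp: N_def)
    have N1: "2 * n * p \<le> card N" using dvd_card_N dvd_imp_le subgroup_card_pos[OF subgroup_N] by blast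
    have "(p + 1) * (2 * (2 * n * p)) \<le> card (carrier G)"
    proof (cases "centralizer y = carrier G")
      case True
      then have "tors \<inter> centralizer y = tors" by (auto simp: roots_def)
      then have "card (tors \<inter> centralizer x) = card tors" using tors_eq by simp
      then have "tors \<inter> centralizer x = tors" using finite_roots by (metis card_subset_eq inf_le1)
      then have "z \<in> centralizer x" using z(1) by blast
      then have "x \<in> N" using centralizer_sym[OF xG] True xG by (auto simp: N_def)
      then have "(p + 1) * (2 * (2 * n * p)) \<le> (p + 1) * card N" using N_proper by (intro mult_le_mono2)
      also have "\<dots> \<le> card (carrier G)" using ge True by simp
      finally show ?thesis .
    next
      case False
      have "(p + 1) * (2 * n * p) \<le> (p + 1) * card N" using N1 by (rule mult_le_mono2)
      then have "(p + 1) * (2 * n * p) \<le> card (centralizer y)" using ge by linarith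
      moreover have "centralizer y \<subset> carrier G" using False by (auto simp: centralizer_def)
      then have "2 * card (centralizer y) \<le> card (carrier G)"
        by (rule subgroup_double[OF subgroup_centralizer[OF yG] subgroup_self])
      moreover have "(p + 1) * (2 * (2 * n * p)) = 2 * ((p + 1) * (2 * n * p))" by simp
      ultimately show ?thesis by linarith
    qed
    moreover have "(p + 1) * (2 * (2 * 2 * p)) \<le> (p + 1) * (2 * (2 * n * p))"
      using n_ge_2 by (intro mult_le_mono) auto
    moreover have "8 * p ^ 2 \<le> (p + 1) * (2 * (2 * 2 * p))" by (simp add: power2_eq_square)
    ultimately show False using small by linarith
  qed
qed

lemma exists_tors_inter_centralizer_x:
  "\<exists>w \<in> tors. w \<noteq> \<one> \<and> w \<in> centralizer x \<and> tors \<inter> centralizer x = cyc w"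
proof -
  have c: "card (tors \<inter> centralizer x) = p"
    using tors_eq tors_inter_centralizer_y card_cyc[OF zG] ord_z by simp
  have "\<not> tors \<inter> centralizer x \<subseteq> {\<one>}"
    using c p_ge_3 card_mono[of "{\<one>}" "tors \<inter> centralizer x"] by auto
  then obtain w where w: "w \<in> tors" "w \<in> centralizer x" "w \<noteq> \<one>" by blast
  have "cyc w \<subseteq> tors \<inter> centralizer x"
    using cyc_subset_tors[OF w(1)] cyc_subset[OF w(2) subgroup_centralizer[OF xG]] by blast
  moreover have "card (cyc w) = p" using tors_nontriv[OF w(1,3)] card_cyc by simp
  ultimately have "cyc w = tors \<inter> centralizer x" using c finite_roots by (metis card_subset_eq finite_Int)
  then show ?thesis using w by blast
qed

definition A :: "'a set" where "A = roots 2 y \<inter> centralizer z"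

text \<open>
  Let \<open>k\<close> and \<open>l\<close> count the square roots that commute, respectively do not commute, with the
  \<open>p\<close>-torsion of the centralizer. The sums \<open>k + l\<close> agree for \<open>x\<close> and \<open>y\<close>, while \<open>p k + l\<close> is larger for
  \<open>y\<close>. As the values of \<open>l\<close> are multiples of \<open>p\<close>, so is the amount by which \<open>k\<close> grows and
  \<open>l\<close> drops.
\<close>

lemma commuting_roots_difference:
  assumes w: "w \<in> tors" "w \<noteq> \<one>" "w \<in> centralizer x" "tors \<inter> centralizer x = cyc w"
  shows "\<exists>j>0. card A = card (roots 2 x \<inter> centralizer w) + p * j
     \<and> card (roots 2 x - centralizer w) > 0 \<and> (even n \<longrightarrow> even j)"
proof -
  note w' = tors_nontriv[OF w(1,2)]
  let ?kx = "card (roots 2 x \<inter> centralizer w)" and ?lx = "card (roots 2 x - centralizer w)"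
  let ?ky = "card A" and ?ly = "card (roots 2 y - centralizer z)"
  have split: "card (R \<inter> C) + card (R - C) = card R" if "finite R" for R C :: "'a set"
    using that by (metis Int_Diff_disjoint Int_Diff_Un card_Un_disjoint finite_Diff finite_Int)
  have s: "?kx + ?lx = ?ky + ?ly" using split[OF finite_roots] sqrt_eq by (simp add: A_def)
  have sx: "(\<Sum>a\<in>roots 2 x. weight a) = p * ?kx + ?lx"
    using sum_weight[OF xG w' w(4)] .
  have sy: "(\<Sum>a\<in>roots 2 y. weight a) = p * ?ky + ?ly"
    using sum_weight[OF yG zG ord_z tors_inter_centralizer_y] by (simp add: A_def)
  have lt: "p * ?kx + ?lx < p * ?ky + ?ly" using sum_less sx sy by simp
  have k: "?kx < ?ky"
  proof (rule ccontr)
    assume "\<not> ?kx < ?ky"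
    then obtain d where d: "?kx = ?ky + d" by (metis le_Suc_ex not_le)
    then have "?ly = ?lx + d" using s by simp
    then have "p * d < d" using lt d by (simp add: algebra_simps)
    then show False using p_ge_3 by simp
  qed
  obtain d where d: "?ky = ?kx + d" "d > 0" using less_imp_add_positive[OF k] by metis
  then have ld: "?lx = ?ly + d" using s by simp
  have "p dvd ?lx" using prime_dvd_noncommuting_roots[OF xG w(3)] w' prime_p by simp
  moreover have "p dvd ?ly" using prime_dvd_noncommuting_roots[OF yG y_mem(2)] ord_z prime_p by simp
  ultimately have "p dvd d" using ld by (metis dvd_add_right_iff)
  then obtain j where j: "d = p * j" by blast
  have "even j" if "even n"
  proof -
    have "even ?kx" using even_commuting_roots[OF xG _ w(3)] that ord_eq by simp
    moreover have "even ?ky" unfolding A_def using even_commuting_roots[OF yG _ y_mem(2)] that by simp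
    ultimately show ?thesis using d(1) j odd_p by (metis even_add even_mult_iff)
  qed
  moreover have "j > 0" using d j by (cases j) auto
  moreover have "?lx > 0" using ld d by simp
  ultimately show ?thesis using d j by blast
qed

text \<open>
  For even \<open>n\<close> the difference \<open>p j\<close> of \<open>commuting_roots_difference\<close> has even \<open>j > 0\<close>; for odd \<open>n\<close> the root of \<open>x\<close> in \<open>\<langle>x\<rangle>\<close> adds
  one to \<open>p\<close>.
\<close>

lemma A_card:
  shows "even n \<Longrightarrow> card A \<ge> 2 * p" and "odd n \<Longrightarrow> card A \<ge> p + 1"
proof -
  obtain w where w: "w \<in> tors" "w \<noteq> \<one>" "w \<in> centralizer x" "tors \<inter> centralizer x = cyc w"
    using exists_tors_inter_centralizer_x by blast
  obtain j where j: "j > 0" "card A = card (roots 2 x \<inter> centralizer w) + p * j" "even n \<Longrightarrow> even j"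
    using commuting_roots_difference[OF w] by blast
  show "card A \<ge> 2 * p" if "even n"
  proof -
    have "j \<ge> 2" using j(1) j(3)[OF that] by presburger
    then have "p * 2 \<le> p * j" by (rule mult_le_mono2)
    then show ?thesis using j(2) by linarith
  qed
  show "card A \<ge> p + 1" if o: "odd n"
  proof -
    let ?e = "x [^] ((ord x + 1) div 2)"
    have "?e \<in> roots 2 x" using weight_pow_sqrt(1)[OF xG] o ord_eq by simp
    moreover have "?e \<in> centralizer w"
      by (rule subgroup_pow_closed[OF subgroup_centralizer[OF tors_nontriv(1)[OF w(1,2)]] centralizer_sym[OF xG w(3)]])
    ultimately have "card (roots 2 x \<inter> centralizer w) > 0" using finite_roots by (auto simp: card_gt_0_iff)
    moreover have "p * 1 \<le> p * j" using j(1) by (intro mult_le_mono2) simp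
    ultimately show ?thesis using j(2) by linarith
  qed
qed

definition v :: 'a where "v = y \<otimes> z"

lemma vG: "v \<in> carrier G" using yG zG by (simp add: v_def)

lemma yz_comm: "y \<otimes> z = z \<otimes> y" using y_mem by (simp add: centralizer_def)

lemma mem_cyc_v: "y \<in> cyc v" "z \<in> cyc v"
proof -
  obtain i j where ij: "p * i = n * j + 1"
    using nat_inverse_mod[of p n] coprime_2n_p p_ge_3 by (auto simp: coprime_commute)
  have "v [^] (p * i) = y [^] (p * i) \<otimes> z [^] (p * i)"
    unfolding v_def using yz_comm yG zG by (rule pow_mult_distrib)
  also have "z [^] (p * i) = \<one>" using zG ord_z by (simp add: pow_eq_id)
  also have "y [^] (p * i) = y"
    using yG pow_ord_eq_1[OF yG] by (simp add: ij nat_pow_pow[symmetric])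
  finally have "y = v [^] (p * i)" using yG by simp
  then show *: "y \<in> cyc v" using mem_cyc_iff[OF vG] by blast
  have "inv y \<otimes> v \<in> cyc v"
    using * self_in_cyc by (intro subgroup.m_closed[OF subgroup_cyc[OF vG]] subgroup.m_inv_closed[OF subgroup_cyc[OF vG]])
  moreover have "inv y \<otimes> v = z" using yG zG by (simp add: v_def flip: m_assoc)
  ultimately show "z \<in> cyc v" by simp
qed

lemma ord_v: "ord v = n * p"
proof (rule dvd_antisym)
  have "v [^] (n * p) = y [^] (n * p) \<otimes> z [^] (n * p)"
    unfolding v_def using yz_comm yG zG by (rule pow_mult_distrib)
  also have "y [^] (n * p) = \<one>" using yG pow_eq_id by simp
  also have "z [^] (n * p) = \<one>" using zG ord_z pow_eq_id by simp
  finally have "v [^] (n * p) = \<one>" by simp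
  then show "ord v dvd n * p" using vG pow_eq_id by simp
  show "n * p dvd ord v"
    using ord_dvd_subgroup[OF subgroup_cyc[OF vG] mem_cyc_v(1)] ord_dvd_subgroup[OF subgroup_cyc[OF vG] mem_cyc_v(2)]
      coprime_2n_p unfolding card_cyc[OF vG] ord_z by (auto intro: divides_mult)
qed

lemma v_in_N: "v \<in> N" using mem_N subgroup_N by (simp add: v_def subgroup.m_closed)

lemma A_subset_N: "A \<subseteq> N"
  using root_centralizer_subset(2) by (auto simp: A_def N_def)

lemma v_comm:
  assumes "h \<in> N" shows "v \<otimes> h = h \<otimes> v"
proof -
  have h: "h \<in> carrier G" "h \<otimes> y = y \<otimes> h" "h \<otimes> z = z \<otimes> h" using assms by (auto simp: N_def centralizer_def)
  have "v \<otimes> h = y \<otimes> (h \<otimes> z)" using h yG zG by (simp add: v_def m_assoc)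
  also have "\<dots> = (y \<otimes> h) \<otimes> z" using h(1) yG zG by (simp add: m_assoc)
  also have "\<dots> = h \<otimes> y \<otimes> z" using h(2) by simp
  finally show ?thesis using h(1) yG zG by (simp add: v_def m_assoc)
qed

lemma square_A_mult:
  assumes a: "a \<in> A"
  shows "(a \<otimes> v [^] (k::nat)) \<otimes> (a \<otimes> v [^] k) = y \<otimes> (v [^] (2::nat)) [^] k"
proof -
  have ac: "a \<in> carrier G" "a \<otimes> a = y" using a by (auto simp: A_def root2)
  have "v \<otimes> a = a \<otimes> v" using v_comm A_subset_N a by blast
  then have c: "v [^] k \<otimes> a = a \<otimes> v [^] k" using group_commutes_pow vG ac by blast
  have "(a \<otimes> v [^] k) \<otimes> (a \<otimes> v [^] k) = a \<otimes> (v [^] k \<otimes> a) \<otimes> v [^] k" using ac vG by (simp add: m_assoc)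
  also have "\<dots> = (a \<otimes> a) \<otimes> (v [^] k \<otimes> v [^] k)" unfolding c using ac(1) vG by (simp add: m_assoc)
  also have "\<dots> = y \<otimes> (v [^] (2::nat)) [^] k" using ac vG by (simp add: nat_pow_mult nat_pow_pow mult_2)
  finally show ?thesis .
qed

text \<open>
  Multiplying a root of \<open>y\<close> by \<open>v\<^sup>k\<close> multiplies its square by \<open>(v\<^sup>2)\<^sup>k\<close>, so the square determines \<open>k\<close>
  below the order of \<open>v\<^sup>2\<close>.
\<close>

lemma inj_on_A_mult: "inj_on (\<lambda>(a, k). a \<otimes> v [^] (k::nat)) (A \<times> {..<ord (v [^] (2::nat))})"
proof (rule inj_onI, clarify)
  let ?o = "ord (v [^] (2::nat))"
  fix a k a' k' assume m: "a \<in> A" "a' \<in> A" "k < ?o" "k' < ?o" and e: "a \<otimes> v [^] k = a' \<otimes> v [^] (k'::nat)"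
  have ac: "a \<in> carrier G" "a' \<in> carrier G" using m by (auto simp: A_def roots_def)
  have "y \<otimes> (v [^] (2::nat)) [^] k = y \<otimes> (v [^] (2::nat)) [^] k'"
    using square_A_mult m e by metis
  then have "(v [^] (2::nat)) [^] k = (v [^] (2::nat)) [^] k'" using yG vG by simp
  then have "k = k'" using pow_inj_lt_ord m(3,4) vG by blast
  moreover have "a = a'" using e ac vG by (simp add: \<open>k = k'\<close>)
  ultimately show "a = a' \<and> k = k'" by simp
qed

lemma A_mult_in_N: "(\<lambda>(a, k). a \<otimes> v [^] (k::nat)) ` (A \<times> K) \<subseteq> N"
  using A_subset_N subgroup_N subgroup_pow_closed[OF subgroup_N v_in_N] by (auto intro: subgroup.m_closed)

lemma card_A_le: "card A * ord (v [^] (2::nat)) \<le> card N"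
  using card_inj_on_le[OF inj_on_A_mult A_mult_in_N finite_subgroup[OF subgroup_N]]
  by (simp add: card_cartesian_product)

lemma ord_v2: "even n \<Longrightarrow> 2 * ord (v [^] (2::nat)) = n * p" "odd n \<Longrightarrow> ord (v [^] (2::nat)) = n * p"
proof -
  have o: "ord (v [^] (2::nat)) = n * p div gcd (n * p) 2" using ord_pow_gen[OF vG, of 2] ord_v by simp
  show "2 * ord (v [^] (2::nat)) = n * p" if "even n" using o that by (simp add: gcd_nat.absorb2)
  show "ord (v [^] (2::nat)) = n * p" if "odd n"
  proof -
    have "coprime (n * p) 2" using that odd_p by (simp add: coprime_right_2_iff_odd)
    then show ?thesis using o by (simp add: coprime_iff_gcd_eq_1)
  qed
qed

lemma card_N_ge: "n * p ^ 2 \<le> card N"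
proof (cases "even n")
  case True
  have "(2 * p) * ord (v [^] (2::nat)) \<le> card A * ord (v [^] (2::nat))" using A_card(1)[OF True] by (rule mult_le_mono1)
  also have "\<dots> \<le> card N" by (rule card_A_le)
  finally show ?thesis using ord_v2(1)[OF True] by (metis mult.assoc mult.commute power2_eq_square)
next
  case False
  have "p * (n * p) \<le> card A * ord (v [^] (2::nat))" using A_card(2)[OF False] ord_v2(2)[OF False] by (intro mult_le_mono) auto
  also have "\<dots> \<le> card N" by (rule card_A_le)
  finally show ?thesis by (simp add: power2_eq_square ac_simps)
qed

text \<open>
  Any further subgroup of order \<open>p\<close> gives \<open>C(z)\<close> index at least \<open>p + 1 \<ge> 4\<close>, and
  \<open>|C(z)| \<ge> |N| \<ge> 2p\<^sup>2\<close>.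
\<close>

lemma tors_eq_cyc: "tors = cyc z"
proof
  show "cyc z \<subseteq> tors" by (rule cyc_subset_tors[OF z(1)])
  show "tors \<subseteq> cyc z"
  proof (rule subsetI, rule ccontr)
    fix w assume w: "w \<in> tors" "w \<notin> cyc z"
    have wz: "w \<notin> centralizer z" using commuting_tors[OF z(1,2)] w by blast
    have "w \<noteq> \<one>" using w subgroup.one_closed[OF subgroup_cyc[OF zG]] by auto
    then have ow: "ord w = p" using tors_nontriv w by blast
    note sub = subgroup_centralizer[OF zG]
    have "z \<in> centralizer z" using zG by (simp add: centralizer_def)
    then have "p dvd card (centralizer z)" using ord_dvd_subgroup[OF sub] ord_z by metis
    then have "(p + 1) * card (centralizer z) \<le> card (carrier G)"
      using index_ge_Suc_prime[OF subgroup_self sub _ _ wz ow prime_p] p_square_not_dvd w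
      by (auto simp: roots_def centralizer_def)
    moreover have "card N \<le> card (centralizer z)"
      using finite_subgroup[OF sub] by (intro card_mono) (auto simp: N_def)
    then have "2 * p ^ 2 \<le> card (centralizer z)"
      using card_N_ge mult_le_mono1[OF n_ge_2, of "p ^ 2"] by linarith
    then have "4 * (2 * p ^ 2) \<le> (p + 1) * card (centralizer z)"
      using p_ge_3 by (intro mult_le_mono) auto
    ultimately show False using small by linarith
  qed
qed

lemma z_comm_x: "z \<in> centralizer x" "tors \<inter> centralizer x = cyc z"
proof -
  have "card (tors \<inter> centralizer x) = card tors"
    using tors_eq tors_inter_centralizer_y tors_eq_cyc by simp
  then have e: "tors \<inter> centralizer x = tors" using finite_roots by (metis card_subset_eq inf_le1)
  then show "tors \<inter> centralizer x = cyc z" using tors_eq_cyc by simp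
  show "z \<in> centralizer x" using e z(1) by blast
qed

lemma x_mem: "x \<in> centralizer z" using centralizer_sym[OF xG z_comm_x(1)] .

text \<open>
  By \<open>commuting_roots_difference\<close> some square root of \<open>x\<close> does not commute with \<open>z\<close>.
\<close>

lemma centralizer_z_proper: "2 * card (centralizer z) \<le> card (carrier G)"
proof (rule subgroup_double[OF subgroup_centralizer[OF zG] subgroup_self])
  have "card (roots 2 x - centralizer z) > 0" using commuting_roots_difference[OF z(1,2) z_comm_x] by blast
  then obtain a where "a \<in> roots 2 x" "a \<notin> centralizer z" by (metis DiffE card_gt_0_iff ex_in_conv)
  then show "centralizer z \<subset> carrier G" by (auto simp: roots_def centralizer_def)
qed

lemma N_eq: "N = centralizer z"
proof (rule ccontr)
  assume "N \<noteq> centralizer z"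
  then have "N \<subset> centralizer z" by (auto simp: N_def)
  then have "2 * card N \<le> card (centralizer z)" by (rule subgroup_double[OF subgroup_N subgroup_centralizer[OF zG]])
  then have "4 * (n * p ^ 2) \<le> card (carrier G)" using centralizer_z_proper card_N_ge by linarith
  moreover have "4 * (2 * p ^ 2) \<le> 4 * (n * p ^ 2)" using n_ge_2 by (intro mult_le_mono) auto
  ultimately show False using small by linarith
qed

lemma card_N_small: "card N < 4 * p ^ 2"
  using centralizer_z_proper N_eq small by simp

lemma xN: "x \<in> N" using x_mem N_eq by simp

lemma cyc_v_comm:
  assumes "c \<in> cyc v" "h \<in> N" shows "c \<otimes> h = h \<otimes> c"
proof -
  have hc: "h \<in> carrier G" using subgroup.mem_carrier[OF subgroup_N assms(2)] .
  obtain k :: nat where "c = v [^] k" using assms(1) mem_cyc_iff[OF vG] by blast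
  then show ?thesis using group_commutes_pow[of v h k] v_comm[OF assms(2)] vG hc by simp
qed

lemma cyc_v_subset: "cyc v \<subseteq> N" by (rule cyc_subset[OF v_in_N subgroup_N])

text \<open>
  For odd \<open>n\<close> the \<open>|A| n p\<close> products of roots of \<open>y\<close> with powers of \<open>v\<close> all square into the central
  subgroup \<open>\<langle>v\<rangle>\<close> of \<open>N\<close>, whereas \<open>x\<^sup>2\<close> is not in it since \<open>x\<close> is a power of \<open>x\<^sup>2\<close>. The three
  quarters bound makes \<open>|N|\<close> at least \<open>4p(p + 1)\<close>.
\<close>

lemma n_even: "even n"
proof (rule ccontr)
  assume o: "odd n"
  have "x \<otimes> x \<notin> cyc v"
  proof
    assume "x \<otimes> x \<in> cyc v"
    then have "x [^] (2::nat) \<in> cyc v" using xG by (simp add: numeral_2_eq_2)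
    then have "(x [^] (2::nat)) [^] ((ord x + 1) div 2) \<in> cyc v" by (rule subgroup_pow_closed[OF subgroup_cyc[OF vG]])
    then have "x \<in> cyc v" using half_pow(1)[OF xG] o ord_eq by simp
    then show False using not_cyc[OF vG] mem_cyc_v by blast
  qed
  from card_squares_in_central_subgroup[OF subgroup_N subgroup_cyc[OF vG] cyc_v_subset cyc_v_comm xN this]
  have le: "4 * card {t \<in> N. t \<otimes> t \<in> cyc v} \<le> 3 * card N" .
  have "(\<lambda>(a, k). a \<otimes> v [^] (k::nat)) ` (A \<times> {..<ord (v [^] (2::nat))}) \<subseteq> {t \<in> N. t \<otimes> t \<in> cyc v}"
  proof -
    have "a \<otimes> v [^] k \<in> {t \<in> N. t \<otimes> t \<in> cyc v}" if a: "a \<in> A" for a and k :: nat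
    proof -
    have "(v [^] (2::nat)) [^] k \<in> cyc v"
      using self_in_cyc subgroup_pow_closed[OF subgroup_cyc[OF vG]] by blast
    then have "y \<otimes> (v [^] (2::nat)) [^] k \<in> cyc v"
      using mem_cyc_v subgroup_cyc[OF vG] by (simp add: subgroup.m_closed)
    then show ?thesis
      using square_A_mult[OF a, of k] A_mult_in_N[of UNIV] a by auto
    qed
    then show ?thesis by auto
  qed
  from card_inj_on_le[OF inj_on_A_mult this] have "card A * (n * p) \<le> card {t \<in> N. t \<otimes> t \<in> cyc v}"
    using finite_subgroup[OF subgroup_N] ord_v2(2)[OF o] by (simp add: card_cartesian_product)
  moreover have "(p + 1) * (3 * p) \<le> card A * (n * p)"
  proof -
    have "n \<ge> 3" using n_ge_2 o by (cases "n = 2") auto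
    then show ?thesis using A_card(2)[OF o] by (intro mult_le_mono) auto
  qed
  moreover have "(p + 1) * (3 * p) \<ge> 3 * p ^ 2" by (simp add: power2_eq_square)
  ultimately have "12 * p ^ 2 \<le> 3 * card N" using le by linarith
  then show False using card_N_small by linarith
qed

lemma n_eq_2: "n = 2"
proof (rule ccontr)
  assume "n \<noteq> 2"
  then have "n \<ge> 4" using n_even n_ge_2 by (cases "n = 3") auto
  then have "4 * p ^ 2 \<le> n * p ^ 2" by (rule mult_le_mono1)
  then show False using card_N_ge card_N_small by linarith
qed

lemma involutions: "x \<otimes> x = \<one>" "x \<noteq> \<one>" "y \<otimes> y = \<one>" "y \<noteq> \<one>" "x \<noteq> y"
proof -
  have o: "ord y = 2" "ord x = 2" using n_eq_2 ord_eq by auto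
  show "x \<otimes> x = \<one>" using pow_ord_eq_1[OF xG] xG by (simp add: o numeral_2_eq_2)
  show "y \<otimes> y = \<one>" using pow_ord_eq_1[OF yG] yG by (simp add: o numeral_2_eq_2)
  show "x \<noteq> \<one>" "y \<noteq> \<one>" using o by auto
  show "x \<noteq> y" using not_cyc[OF yG] self_in_cyc by blast
qed

lemma y_central: "h \<in> N \<Longrightarrow> y \<otimes> h = h \<otimes> y"
  by (simp add: N_def centralizer_def)

text \<open>
  The products of roots of \<open>y\<close> with powers of \<open>v\<close> are more than half of \<open>N\<close>, so their set meets its
  translate by \<open>x\<close>. This gives a root \<open>a\<close> for which \<open>ax\<close> is again a root up to a central factor \<open>c\<close>.
  Then \<open>xax = ac\<^sup>2\<close>, and conjugating once more by \<open>x\<close> gives \<open>c\<^sup>4 = 1\<close>. As \<open>c\<close> has order dividing \<open>2p\<close>,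
  already \<open>c\<^sup>2 = 1\<close>.
\<close>

lemma exists_root_commuting_with_x: "\<exists>a \<in> A. x \<otimes> a = a \<otimes> x"
proof -
  let ?f = "\<lambda>(a, k). a \<otimes> v [^] (k::nat)" and ?D = "A \<times> {..<ord (v [^] (2::nat))}"
  define T where "T = ?f ` ?D"
  have o: "ord (v [^] (2::nat)) = p" using ord_v2(1)[OF n_even] n_eq_2 by simp
  have TN: "T \<subseteq> N" unfolding T_def by (rule A_mult_in_N)
  note finN = finite_subgroup[OF subgroup_N]
  note carN = subgroup.mem_carrier[OF subgroup_N]
  have finT: "finite T" using TN finN by (rule finite_subset)
  have "card T = card A * p"
    using card_image[OF inj_on_A_mult] o by (simp add: T_def card_cartesian_product)
  moreover have "2 * p * p \<le> card A * p" using A_card(1)[OF n_even] by (rule mult_le_mono1)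
  ultimately have cT: "card N < 2 * card T" 
    using card_N_small[unfolded power2_eq_square] by linarith
  define T' where "T' = (\<lambda>t. t \<otimes> x) ` T"
  have T'N: "T' \<subseteq> N" using TN xN subgroup_N by (auto simp: T'_def intro: subgroup.m_closed)
  have "T \<subseteq> carrier G" using TN carN by blast
  then have "inj_on (\<lambda>t. t \<otimes> x) T" using xG by (auto intro!: inj_onI simp: subset_iff)
  then have cT': "card T' = card T" by (simp add: T'_def card_image)
  have "T \<inter> T' \<noteq> {}"
  proof
    assume "T \<inter> T' = {}"
    then have "card (T \<union> T') = card T + card T'"
      using finT by (intro card_Un_disjoint) (auto simp: T'_def)
    moreover have "card (T \<union> T') \<le> card N" using TN T'N finN by (intro card_mono) auto
    ultimately show False using cT cT' by simp
  qed
  then obtain a k a' k' where a: "a \<in> A" "a' \<in> A" and e: "a \<otimes> v [^] (k::nat) \<otimes> x = a' \<otimes> v [^] (k'::nat)"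
  proof -
    obtain t s where ts: "t \<in> T" "s \<in> T" "t = s \<otimes> x" using \<open>T \<inter> T' \<noteq> {}\<close> by (auto simp only: T'_def)
    from ts(1) obtain a' k' where 1: "a' \<in> A" "t = a' \<otimes> v [^] (k'::nat)" unfolding T_def by auto
    from ts(2) obtain a k where 2: "a \<in> A" "s = a \<otimes> v [^] (k::nat)" unfolding T_def by auto
    show ?thesis using that[OF 2(1) 1(1)] 1(2) 2(2) ts(3) by metis
  qed
  define c where "c = v [^] k' \<otimes> inv (v [^] k)"
  have vk: "v [^] k \<in> cyc v" "v [^] k' \<in> cyc v" using mem_cyc_iff[OF vG] by blast+
  then have cv: "c \<in> cyc v" using subgroup_cyc[OF vG] by (simp add: c_def subgroup.m_closed subgroup.m_inv_closed)
  have cc: "c \<in> carrier G" using vG by (simp add: c_def)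
  have ac: "a \<in> carrier G" "a' \<in> carrier G" "a \<otimes> a = y" "a' \<otimes> a' = y" using a by (auto simp: A_def root2)
  have aN: "a \<in> N" "a' \<in> N" using a A_subset_N by auto
  have "a \<otimes> x \<otimes> v [^] k = a' \<otimes> v [^] k'"
    using e cyc_v_comm[OF vk(1) xN] ac xG vG by (simp add: m_assoc)
  then have "a \<otimes> x = a' \<otimes> v [^] k' \<otimes> inv (v [^] k)"
    using ac xG vG by (simp add: inv_solve_right)
  then have ax: "a \<otimes> x = a' \<otimes> c" using ac vG by (simp add: c_def m_assoc)
  have "a \<otimes> x \<otimes> (a \<otimes> x) = a' \<otimes> (c \<otimes> a') \<otimes> c" unfolding ax using ac cc by (simp add: m_assoc)
  also have "c \<otimes> a' = a' \<otimes> c" using cyc_v_comm[OF cv aN(2)] .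
  also have "a' \<otimes> (a' \<otimes> c) \<otimes> c = (a' \<otimes> a') \<otimes> (c \<otimes> c)" using ac(1,2) cc by (simp add: m_assoc)
  also have "\<dots> = (a \<otimes> a) \<otimes> (c \<otimes> c)" using ac by simp
  finally have "a \<otimes> (x \<otimes> (a \<otimes> x)) = a \<otimes> (a \<otimes> (c \<otimes> c))" using ac(1) xG cc by (simp add: m_assoc)
  then have xax: "x \<otimes> (a \<otimes> x) = a \<otimes> (c \<otimes> c)" using ac(1) xG cc by simp
  have ccv: "c \<otimes> c \<in> cyc v" using cv subgroup_cyc[OF vG] by (simp add: subgroup.m_closed)
  have "a = x \<otimes> (x \<otimes> (a \<otimes> x)) \<otimes> x" using involutions(1) ac(1) xG by (simp add: m_assoc) (simp add: m_assoc[symmetric])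
  also have "\<dots> = x \<otimes> (a \<otimes> ((c \<otimes> c) \<otimes> x))" unfolding xax using ac(1) xG cc by (simp add: m_assoc)
  also have "(c \<otimes> c) \<otimes> x = x \<otimes> (c \<otimes> c)" using cyc_v_comm[OF ccv xN] .
  also have "x \<otimes> (a \<otimes> (x \<otimes> (c \<otimes> c))) = (x \<otimes> (a \<otimes> x)) \<otimes> (c \<otimes> c)" using ac(1) xG cc by (simp add: m_assoc)
  also have "\<dots> = a \<otimes> ((c \<otimes> c) \<otimes> (c \<otimes> c))" unfolding xax using ac(1) cc by (simp add: m_assoc)
  finally have e4: "a = a \<otimes> ((c \<otimes> c) \<otimes> (c \<otimes> c))" .
  have "a \<otimes> ((c \<otimes> c) \<otimes> (c \<otimes> c)) = a \<otimes> \<one>" unfolding e4[symmetric] using ac(1) by simp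
  then have c4: "(c \<otimes> c) \<otimes> (c \<otimes> c) = \<one>" using ac(1) cc by simp
  have "c \<otimes> c = \<one>"
  proof -
    have "(c \<otimes> c) [^] (2::nat) = \<one>" using c4 cc by (simp add: numeral_2_eq_2 m_assoc)
    then have 1: "ord (c \<otimes> c) dvd 2" using cc pow_eq_id by simp
    have "ord c dvd 2 * p" using ord_dvd_subgroup[OF subgroup_cyc[OF vG] cv] card_cyc[OF vG] ord_v n_eq_2 by simp
    then have "c [^] (2 * p) = \<one>" using cc pow_eq_id by simp
    then have "(c [^] (2::nat)) [^] p = \<one>" using cc by (simp add: nat_pow_pow)
    then have "(c \<otimes> c) [^] p = \<one>" using cc by (simp add: numeral_2_eq_2)
    then have "ord (c \<otimes> c) dvd p" using cc pow_eq_id by simp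
    then have "ord (c \<otimes> c) = 1" using 1 odd_p by (metis coprime_common_divisor_nat coprime_left_2_iff_odd)
    then show ?thesis using ord_eq_1 cc by simp
  qed
  then have "x \<otimes> (a \<otimes> x) = a" using xax ac(1) by simp
  then have "x \<otimes> (a \<otimes> x) \<otimes> x = a \<otimes> x" by simp
  then have "x \<otimes> a = a \<otimes> x" using involutions(1) ac(1) xG by (simp add: m_assoc)
  then show ?thesis using a by blast
qed

text \<open>
  Both counts of square roots inside \<open>N\<close> are divisible by four: for \<open>y\<close> because of the root commuting
  with \<open>x\<close>, for \<open>x\<close> because \<open>\<langle>x, y\<rangle>\<close> acts by multiplication. Their difference \<open>p j\<close> is then at least
  \<open>4p\<close>, and \<open>|N| \<ge> |A| p\<close> reaches \<open>4p\<^sup>2\<close>.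
\<close>

lemma contradiction: False
proof -
  note inv = involutions
  obtain a where a: "a \<in> A" "x \<otimes> a = a \<otimes> x" using exists_root_commuting_with_x by blast
  have aN: "a \<in> N" "a \<otimes> a = y" using a A_subset_N by (auto simp: A_def root2)
  have "A = {h \<in> N. h \<otimes> h = y}"
    using A_subset_N subgroup.mem_carrier[OF subgroup_N] N_eq by (auto simp: A_def root2)
  then have A4: "4 dvd card A"
    using four_dvd_roots_of_central_involution[OF subgroup_N mem_N(3) inv(3,4) y_central xN inv(1,2,5) aN a(2)] by simp
  note H = subgroup_central_involution_roots[OF subgroup_N mem_N(3) inv(3,4) y_central xN inv(1,2,5)]
  let ?R = "roots 2 x \<inter> centralizer z"
  have "card {\<one>, x, y, x \<otimes> y} dvd card ?R"
  proof (rule card_dvd_right_mult[OF H(1)])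
    show "?R \<subseteq> carrier G" by (auto simp: roots_def)
    fix s h assume s: "s \<in> ?R" and h: "h \<in> {\<one>, x, y, x \<otimes> y}"
    have sN: "s \<in> N" using s N_eq by simp
    have sc: "s \<in> carrier G" "s \<otimes> s = x" using s by (auto simp: root2)
    have hN: "h \<in> N" using h mem_N xN subgroup_N by (auto intro: subgroup.m_closed subgroup.one_closed)
    have hc: "h \<in> carrier G" using subgroup.mem_carrier[OF subgroup_N hN] .
    have "x \<in> centralizer s" using root_centralizer_subset(2)[of s 2 x] centralizer_sym[OF xG] s by blast
    moreover have "y \<in> centralizer s" using y_central[OF sN] yG by (simp add: centralizer_def)
    ultimately have "h \<in> centralizer s" using h subgroup_centralizer[OF sc(1)]
      by (auto intro: subgroup.m_closed subgroup.one_closed)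
    then have hs: "h \<otimes> s = s \<otimes> h" by (simp add: centralizer_def)
    have xy: "x \<otimes> y = y \<otimes> x" using y_central[OF xN] by simp
    have "(x \<otimes> y) \<otimes> (x \<otimes> y) = (x \<otimes> x) \<otimes> (y \<otimes> y)" using xG yG xy by (metis m_assoc m_closed)
    then have hh: "h \<otimes> h = \<one>" using h inv by auto
    have "s \<otimes> h \<otimes> (s \<otimes> h) = s \<otimes> (h \<otimes> s) \<otimes> h" using sc hc by (simp add: m_assoc)
    also have "\<dots> = (s \<otimes> s) \<otimes> (h \<otimes> h)" unfolding hs using sc(1) hc by (simp add: m_assoc)
    finally have "s \<otimes> h \<in> roots 2 x" using sc hc hh xG by (simp add: root2)
    moreover have "s \<otimes> h \<in> centralizer z" using sN hN subgroup_N N_eq by (metis subgroup.m_closed)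
    ultimately show "s \<otimes> h \<in> ?R" by blast
  qed
  then have R4: "4 dvd card ?R" using H(2) by simp
  obtain j where j: "j > 0" "card A = card ?R + p * j"
    using commuting_roots_difference[OF z(1,2) z_comm_x] by blast
  then have "4 dvd p * j" using A4 R4 by (metis dvd_add_right_iff)
  moreover have "coprime 4 p" using odd_p by (metis coprime_left_2_iff_odd coprime_power_left_iff power2_eq_square mult_2_right numeral_Bit0 mult.commute)
  ultimately have "4 dvd j" by (metis coprime_dvd_mult_right_iff)
  then have "4 \<le> j" using j(1) dvd_imp_le by blast
  then have "p * 4 \<le> p * j" by (rule mult_le_mono2)
  then have "4 * p \<le> card A" using j(2) by linarith
  then have "4 * p * p \<le> card A * ord (v [^] (2::nat))"
    using ord_v2(1)[OF n_even] n_eq_2 by (intro mult_le_mono) auto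
  then show False using card_A_le card_N_small by (simp add: power2_eq_square)
qed

end

lemma (in coprime_pair) impossible: False
proof -
  obtain b where b: "b \<in> roots 2 y" "ord b = 2 * n" "weight b \<noteq> 1" using exists_witness by blast
  have bG: "b \<in> carrier G" using b by (simp add: roots_def)
  have "\<not> tors \<inter> centralizer b \<subseteq> {\<one>}"
  proof
    assume "tors \<inter> centralizer b \<subseteq> {\<one>}"
    moreover have "\<one> \<in> tors \<inter> centralizer b" using bG by (simp add: roots_def centralizer_def)
    ultimately have "tors \<inter> centralizer b = {\<one>}" by blast
    then show False using b(3) by simp
  qed
  then obtain z where "z \<in> tors" "z \<noteq> \<one>" "z \<in> centralizer b" by blast
  with b interpret coprime_pair_witness G p x y b z by unfold_locales
  show False by (rule contradiction)
qed

lemma (in finite_group) root_property_order_ge: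
  assumes p: "Factorial_Ring.prime p" "odd p" and rp: "root_property G (2 * p) x y"
  shows "card (carrier G) \<ge> 8 * p ^ 2"
proof (rule ccontr)
  assume "\<not> ?thesis"
  then have small: "card (carrier G) < 8 * p ^ 2" by simp
  have x: "x \<in> carrier G" and y: "y \<in> carrier G" and o: "ord x = ord y"
    and lt: "num_roots G (2 * p) x < num_roots G (2 * p) y"
    and eq: "\<And>l. l < 2 * p \<Longrightarrow> squarefree l \<Longrightarrow> num_roots G l x = num_roots G l y"
    using rp by (auto simp: root_property_def)
  have p3: "p \<ge> 3" using p prime_ge_2_nat[of p] by (cases "p = 2") auto
  have eq2: "num_roots G 2 x = num_roots G 2 y" using eq[of 2] p3 by (simp add: squarefree_prime)
  have eqp: "num_roots G p x = num_roots G p y" using eq[of p] p3 p(1) by (simp add: squarefree_prime)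
  show False
  proof (cases "p dvd ord y")
    case True
    have "card (roots (2 * p) y) > 0" using lt by (simp add: num_roots_eq_card_roots)
    then obtain h where h: "h \<in> carrier G" "h [^] (2 * p) = y" by (auto simp: card_gt_0_iff roots_def)
    then have "h [^] (2::nat) \<in> roots p y" by (simp add: roots_def nat_pow_pow)
    then have "card (roots p x) > 0" using eqp finite_roots by (auto simp: num_roots_eq_card_roots card_gt_0_iff)
    then obtain a where a: "a \<in> carrier G" "a [^] p = x" by (auto simp: card_gt_0_iff roots_def)
    from num_roots_le_if_prime_dvd_ord[OF p small a h o True, of "2 * p"] lt
    show False by simp
  next
    case False
    have cop: "coprime p (2 * ord y)" "coprime p (1 * ord y)"
      using p False by (auto simp: prime_imp_coprime_nat coprime_right_2_iff_odd)
    have p0: "p > 0" using p3 by simp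
    have r1: "roots 1 g = {g}" if "g \<in> carrier G" for g using that by (auto simp: roots_def)
    note split = num_roots_mult_coprime[OF _ _ p0]
    have "num_roots G (p * 1) x = card (roots p \<one> \<inter> centralizer x)"
      using split[OF x, of 1] cop o r1[OF x] by simp
    moreover have "num_roots G (p * 1) y = card (roots p \<one> \<inter> centralizer y)"
      using split[OF y, of 1] cop r1[OF y] by simp
    ultimately have t: "card (roots p \<one> \<inter> centralizer x) = card (roots p \<one> \<inter> centralizer y)"
      using eqp by simp
    have s: "(\<Sum>a\<in>roots 2 x. card (roots p \<one> \<inter> centralizer a))
                 < (\<Sum>b\<in>roots 2 y. card (roots p \<one> \<inter> centralizer b))"
      using split[OF x, of 2] split[OF y, of 2] cop o lt by (simp add: mult.commute)
    have nc: "y \<notin> cyc c" if "c \<in> carrier G" "g \<in> carrier G" "g \<otimes> x \<otimes> inv g \<in> cyc c" for c g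
    proof
      assume yc: "y \<in> cyc c"
      have "num_roots G (2 * p) y \<le> num_roots G (2 * p) (g \<otimes> x \<otimes> inv g)"
        using num_roots_le_in_cyc[OF that(1,3) yc] ord_conj[OF that(2) x] o by simp
      also have "\<dots> \<le> num_roots G (2 * p) x"
      proof -
        have "inv g \<otimes> (g \<otimes> x \<otimes> inv g) \<otimes> inv (inv g) = x"
          using that(2) x by (simp add: m_assoc) (simp add: m_assoc[symmetric])
        then show ?thesis using num_roots_conj_le[of "inv g" "g \<otimes> x \<otimes> inv g" "2 * p"] that(2) x by simp
      qed
      finally show False using lt by simp
    qed
    interpret coprime_pair G p x y
      using p x y o False eq2 t s nc small
      by unfold_locales (simp_all add: num_roots_eq_card_roots)
    show False by (rule impossible)
  qed
qed

theorem theorem4p1: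
  fixes G :: "('a, 'b) monoid_scheme" and p :: nat
  assumes "Factorial_Ring.prime p" and "odd p"
    and "group G" and "finite (carrier G)"
    and "\<exists>x y. root_property G (2 * p) x y"
  shows "card (carrier G) \<ge> 8 * p ^ 2"
proof -
  interpret finite_group G
    using assms(3,4) by (simp add: finite_group_def finite_group_axioms_def)
  show ?thesis using root_property_order_ge assms by blast
qed

end
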